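(* Let $n\ge 2$, $N\ge 1$ and $\tau=2k-1+\epsilon$ with $k\in\mathbb{N}$, $\epsilon\in\{0,1\}$, and assume that there exists a spherical $\tau$-design of cardinality $N$ on $\mathbb{S}^{n-1}$. Let $h$ be a potential that is continuous on $[-1,1]$, finite on $(-1,1)$, and satisfies $h^{(\tau+1)}(t)\ge 0$ for all $t\in(-1,1)$. Let $\{\alpha_i\}_{i=1-\epsilon}^{k}$ be the roots of the polynomial $(1+t)^{\epsilon}P_k^{(0,\epsilon)}(t)$ (so $\alpha_1<\dots<\alpha_k$ are the roots of $P_k^{(0,\epsilon)}$ and, when $\epsilon=1$, additionally $\alpha_0=-1$), let $\ell_i$ denote the Lagrange basic polynomials associated with these nodes, and set $$\rho_i:=\gamma_n\int_{-1}^1 \ell_i(t)(1-t^2)^{(n-3)/2}\,dt,\qquad i=1-\epsilon,\dots,k.$$ Then $\rho_i=\gamma_n\int_{-1}^1 \ell_i(t)^2(1-t^2)^{(n-3)/2}\,dt$, all $\rho_i$ are positive, $\sum_{i=1-\epsilon}^k\rho_i=1$, and $$\mathcal{Q}^{(h)}(n,\tau,N)\ \ge\ N\sum_{i=1-\epsilon}^{k}\rho_i h(\alpha_i),\qquad \mathcal{R}^{(h)}(n,\tau,N)\ \ge\ N\sum_{i=1-\epsilon}^{k}\rho_i h(\alpha_i).$$ Moreover, the first bound is the best that can be obtained from lower admissible polynomials, i.e. $\max_{f\in\mathcal{L}(n,\tau,h)} N f_0 = N\sum_{i=1-\epsilon}^{k}\rho_i h(\alpha_i)$.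
   Context: $\mathbb{S}^{n-1}\subset\mathbb{R}^n$ is the unit sphere; a spherical code is a finite set of distinct points on it. For a function $h:[-1,1]\to(-\infty,+\infty]$ (a potential) and a code $C$, $U_h(x,C):=\sum_{y\in C}h(x\cdot y)$ for $x\in\mathbb{S}^{n-1}$; $\mathcal{Q}_h(C):=\inf_{x\in\mathbb{S}^{n-1}}U_h(x,C)$ and $\mathcal{R}_h(C):=\sup_{x\in\mathbb{S}^{n-1}}U_h(x,C)$. A spherical $\tau$-design is a finite $C\subset\mathbb{S}^{n-1}$ such that the average of every polynomial of degree at most $\tau$ in $n$ variables over $C$ equals its average over $\mathbb{S}^{n-1}$ with respect to surface measure. $\mathcal{Q}^{(h)}(n,\tau,N):=\sup\{\mathcal{Q}_h(C): |C|=N,\ C\text{ a }\tau\text{-design}\}$ and $\mathcal{R}^{(h)}(n,\tau,N):=\inf\{\mathcal{R}_h(C): |C|=N,\ C\text{ a }\tau\text{-design}\}$. The constant $\gamma_n$ is chosen so that $\gamma_n\int_{-1}^1(1-t^2)^{(n-3)/2}dt=1$. For $a,b\in\{0,1\}$, $P_k^{(a,b)}$ denotes the Jacobi polynomial of degree $k$ with parameters $\alpha=a+(n-3)/2$, $\beta=b+(n-3)/2$, normalized by $P_k^{(a,b)}(1)=1$; $P_k^{(0,0)}=P_k^{(n)}$ is the Gegenbauer polynomial. For a polynomial $f=\sum_i f_iP_i^{(n)}$, $f_0=\gamma_n\int_{-1}^1 f(t)(1-t^2)^{(n-3)/2}dt$. $\mathcal{L}(n,\tau,h)$ is the set of real polynomials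 $f$ with $\deg f\le\tau$ and $f(t)\le h(t)$ for all $t\in[-1,1]$. *)

theory Defs
  imports "HOL-Analysis.Analysis" "HOL-Computational_Algebra.Polynomial"
begin

definition mpoly_fun :: "nat \<Rightarrow> (real^'n \<Rightarrow> real) set" where
  "mpoly_fun d = {f. \<exists>(M :: ('n \<Rightarrow> nat) set) (c :: ('n \<Rightarrow> nat) \<Rightarrow> real).
      finite M \<and> (\<forall>m\<in>M. (\<Sum>i\<in>UNIV. m i) \<le> d) \<and>
      (\<forall>x. f x = (\<Sum>m\<in>M. c m * (\<Prod>i\<in>UNIV. (x $ i) ^ (m i))))}"

text \<open>Average over the unit sphere with respect to (normalized) surface measure,
  realised as the cone measure: the normalized surface measure of A is the
  normalized Lebesgue measure of the cone over A inside the unit ball.\<close>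
definition sphere_avg :: "(real^'n \<Rightarrow> real) \<Rightarrow> real" where
  "sphere_avg f = integral (ball 0 1) (\<lambda>x. f ((1 / norm x) *\<^sub>R x))
                  / measure lebesgue (ball (0::real^'n) 1)"

definition spherical_design :: "nat \<Rightarrow> (real^'n) set \<Rightarrow> bool" where
  "spherical_design \<tau> C \<longleftrightarrow> finite C \<and> C \<noteq> {} \<and> C \<subseteq> sphere 0 1 \<and>
     (\<forall>f\<in>mpoly_fun \<tau>. (\<Sum>y\<in>C. f y) / real (card C) = sphere_avg f)"

definition U_pot :: "(real \<Rightarrow> ereal) \<Rightarrow> real^'n \<Rightarrow> (real^'n) set \<Rightarrow> ereal" where
  "U_pot h x C = (\<Sum>y\<in>C. h (x \<bullet> y))"

definition Q_pot :: "(real \<Rightarrow> ereal) \<Rightarrow> (real^'n) set \<Rightarrow> ereal" where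
  "Q_pot h C = (INF x\<in>sphere 0 1. U_pot h x C)"

definition R_pot :: "(real \<Rightarrow> ereal) \<Rightarrow> (real^'n) set \<Rightarrow> ereal" where
  "R_pot h C = (SUP x\<in>sphere 0 1. U_pot h x C)"

definition Q_design :: "'n::finite itself \<Rightarrow> (real \<Rightarrow> ereal) \<Rightarrow> nat \<Rightarrow> nat \<Rightarrow> ereal" where
  "Q_design _ h \<tau> N =
     (SUP C\<in>{C :: (real^'n) set. spherical_design \<tau> C \<and> card C = N}. Q_pot h C)"

definition R_design :: "'n::finite itself \<Rightarrow> (real \<Rightarrow> ereal) \<Rightarrow> nat \<Rightarrow> nat \<Rightarrow> ereal" where
  "R_design _ h \<tau> N =
     (INF C\<in>{C :: (real^'n) set. spherical_design \<tau> C \<and> card C = N}. R_pot h C)"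

definition gegen_weight :: "nat \<Rightarrow> real \<Rightarrow> real" where
  "gegen_weight n t = (1 - t\<^sup>2) powr ((real n - 3) / 2)"

definition gamma_const :: "nat \<Rightarrow> real" where
  "gamma_const n = 1 / integral {-1..1} (gegen_weight n)"

definition coeff0 :: "nat \<Rightarrow> real poly \<Rightarrow> real" where
  "coeff0 n f = gamma_const n * integral {-1..1} (\<lambda>t. poly f t * gegen_weight n t)"

definition jacobi_std :: "nat \<Rightarrow> real \<Rightarrow> real \<Rightarrow> real poly" where
  "jacobi_std k al be = (\<Sum>s\<le>k. smult (((real k + al) gchoose (k - s)) * ((real k + be) gchoose s))
       ([:-1/2, 1/2:] ^ s * [:1/2, 1/2:] ^ (k - s)))"

definition jacobi_norm :: "nat \<Rightarrow> real \<Rightarrow> real \<Rightarrow> real poly" where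
  "jacobi_norm k al be = smult (1 / poly (jacobi_std k al be) 1) (jacobi_std k al be)"

definition P_ab :: "nat \<Rightarrow> nat \<Rightarrow> nat \<Rightarrow> nat \<Rightarrow> real poly" where
  "P_ab n a b k = jacobi_norm k (real a + (real n - 3) / 2) (real b + (real n - 3) / 2)"

definition lagrange_basis :: "real set \<Rightarrow> real \<Rightarrow> real poly" where
  "lagrange_basis S a = (\<Prod>b\<in>S - {a}. smult (1 / (a - b)) [:-b, 1:])"

definition admissible_lower :: "nat \<Rightarrow> nat \<Rightarrow> (real \<Rightarrow> ereal) \<Rightarrow> real poly set" where
  "admissible_lower n \<tau> h = {f. degree f \<le> \<tau> \<and> (\<forall>t\<in>{-1..1}. ereal (poly f t) \<le> h t)}"

end

theory Submission
  imports Defs "HOL-Probability.Distributions"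
begin

text \<open>
  Orthogonality of the Jacobi polynomial makes the nodes a Gauss (or Gauss--Radau) quadrature, exact
  up to degree \<open>\<tau>\<close>. The Hermite interpolant \<open>f\<close> of \<open>h\<close>, double at the inner nodes and simple at \<open>-1\<close>,
  lies below \<open>h\<close> because the error is a nonnegative multiple of \<open>h\<^sup>(\<^sup>\<tau>\<^sup>+\<^sup>1\<^sup>)\<close>. For a design \<open>C\<close> and a unit
  vector \<open>x\<close>, summing \<open>f (x \<bullet> y) \<le> h (x \<bullet> y)\<close> over \<open>C\<close> gives \<open>N f\<^sub>0\<close>, which the quadrature turns into
  the stated value; any other admissible polynomial is dominated by \<open>f\<close> at the nodes.
  That \<open>f\<^sub>0\<close> is the average of \<open>f (x \<bullet> y)\<close> over the sphere follows by comparing moments: the Gaussian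
  integral of \<open>(x \<bullet> y)\<^sup>j\<close> is a product in Cartesian coordinates and factors in polar coordinates.
\<close>

section \<open>Hermite interpolation from below\<close>

text \<open>The argument rests on a count: two conditions at each of the \<open>k\<close> inner
  nodes and \<open>\<epsilon>\<close> at \<open>-1\<close> make \<open>\<tau> + 1\<close>. Hence the
  interpolant has degree at most \<open>\<tau>\<close>, the quadrature is exact for it, and the
  error carries exactly the derivative of known sign. The remaining factor is a square times a power
  of \<open>1 + t\<close>, nonnegative inside the interval; this is why inner nodes are double and
  \<open>-1\<close> is simple. Exactness on squares of Lagrange polynomials, of degree
  \<open>2 * (k + \<epsilon> - 1) \<le> \<tau>\<close>, gives the positive weights. Two obstacles
  shape the proof. The potential may be infinite at an endpoint, so the error estimate runs inside
  the interval, includes \<open>-1\<close> only when it is a node, and reaches the other endpoints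
  by continuity in \<open>ereal\<close>. And \<open>sphere_avg\<close> is a cone average over the
  ball, so the passage to one variable is made through moments instead of slices of the sphere. The
  second bound follows from the first estimate because infimum is at most supremum for each single
  design.\<close>

text \<open>The witness \<open>R\<close> consists of the zeros of odd order in the interval:
  splitting one linear factor off \<open>p\<close> toggles whether its root belongs to the set of
  the quotient. It is used to count the roots of the Jacobi polynomial.\<close>

lemma sign_change_factor:
  fixes p :: "real poly"
  assumes "p \<noteq> 0"
  shows "\<exists>R c. finite R \<and> R \<subseteq> {a<..<b} \<and> (\<forall>r\<in>R. poly p r = 0) \<and> c \<in> {1,-1} \<and>
           (\<forall>t\<in>{a<..<b}. c * poly (p * (\<Prod>r\<in>R. [:-r,1:])) t \<ge> 0)"
  using assms
proof (induction "degree p" arbitrary: p rule: less_induct)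
  case less
  show ?case
  proof (cases "\<exists>r\<in>{a<..<b}. poly p r = 0")
    case False
    have same: "\<not> (poly p u < 0 \<and> 0 < poly p v)" if "u \<in> {a<..<b}" "v \<in> {a<..<b}" for u v
    proof
      assume uv: "poly p u < 0 \<and> 0 < poly p v"
      then have "u \<noteq> v" by auto
      then consider "u < v" | "v < u" by linarith
      then show False
      proof cases
        case 1
        with poly_IVT_pos[OF 1, of p] uv obtain x where "u < x" "x < v" "poly p x = 0" by auto
        with False that show False by auto
      next
        case 2
        with poly_IVT_neg[OF 2, of p] uv obtain x where "v < x" "x < u" "poly p x = 0" by auto
        with False that show False by auto
      qed
    qed
    show ?thesis
    proof (cases "\<exists>u\<in>{a<..<b}. poly p u < 0")
      case True
      then obtain u where u: "u \<in> {a<..<b}" "poly p u < 0" by auto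
      then have "\<forall>t\<in>{a<..<b}. - 1 * poly p t \<ge> 0" using same[OF u(1)] by force
      then show ?thesis by (intro exI[of _ "{}"] exI[of _ "-1"]) auto
    next
      case F: False
      then show ?thesis by (intro exI[of _ "{}"] exI[of _ 1]) (auto simp: not_less)
    qed
  next
    case True
    then obtain r where r: "r \<in> {a<..<b}" "poly p r = 0" by auto
    then obtain q where pq: "p = [:-r,1:] * q" by (metis dvdE poly_eq_0_iff_dvd)
    with less.prems have q0: "q \<noteq> 0" by auto
    then have "degree p = Suc (degree q)" using pq by (simp add: degree_mult_eq del: mult_pCons_left)
    from less.hyps[of q] this q0 obtain R c where R: "finite R" "R \<subseteq> {a<..<b}" "\<forall>r\<in>R. poly q r = 0"
       "c \<in> {1,-1::real}" and sg: "\<forall>t\<in>{a<..<b}. c * poly (q * (\<Prod>r\<in>R. [:-r,1:])) t \<ge> 0"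
      by (metis lessI)
    show ?thesis
    proof (cases "r \<in> R")
      case True
      have e: "(\<Prod>r\<in>R. [:-r,1:]) = [:-r,1:] * (\<Prod>r\<in>R - {r}. [:-r,1:])"
        by (rule prod.remove[OF R(1) True])
      have "p * (\<Prod>r\<in>R - {r}. [:-r,1:]) = q * (\<Prod>r\<in>R. [:-r,1:])"
        unfolding pq e by (simp only: mult_ac)
      with R sg pq show ?thesis
        by (intro exI[of _ "R - {r}"] exI[of _ c]) auto
    next
      case False
      have e: "(\<Prod>r\<in>insert r R. [:-r,1:]) = [:-r,1:] * (\<Prod>r\<in>R. [:-r,1:])"
        by (rule prod.insert[OF R(1) False])
      \<comment> \<open>The root now occurs once in \<open>p\<close> and once in the product, so
        only a square is added and the sign survives.\<close>
      have "c * poly (p * (\<Prod>r\<in>insert r R. [:-r,1:])) t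
          = (t - r)^2 * (c * poly (q * (\<Prod>r\<in>R. [:-r,1:])) t)" for t
        unfolding pq e by (simp add: algebra_simps power2_eq_square)
      then have "\<forall>t\<in>{a<..<b}. c * poly (p * (\<Prod>r\<in>insert r R. [:-r,1:])) t \<ge> 0"
        using sg by (metis mult_nonneg_nonneg zero_le_power2)
      then show ?thesis using R r pq
        by (intro exI[of _ "insert r R"] exI[of _ c]) auto
    qed
  qed
qed

section \<open>Lagrange and Hermite interpolation\<close>

lemma poly_lagrange_basis:
  assumes "finite S" "a \<in> S" "b \<in> S"
  shows "poly (lagrange_basis S a) b = (if a = b then 1 else 0)"
proof (cases "a = b")
  case True
  have "(\<Prod>x\<in>S - {a}. poly (smult (1 / (a - x)) [:-x, 1:]) a) = 1"
    by (rule prod.neutral) (auto simp: divide_simps)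
  then show ?thesis using True by (simp only: lagrange_basis_def poly_prod simp_thms if_True)
next
  case False
  then have "b \<in> S - {a}" using assms by auto
  with False assms show ?thesis
    by (auto simp: lagrange_basis_def poly_prod)
qed

lemma degree_lagrange_basis:
  assumes "finite S" "a \<in> S"
  shows "degree (lagrange_basis S a) < card S"
proof -
  have "degree (lagrange_basis S a) \<le> (\<Sum>b\<in>S - {a}. degree (smult (1 / (a - b)) [:-b, 1:]))"
    unfolding lagrange_basis_def using assms by (intro order_trans[OF degree_prod_sum_le]) (auto simp: o_def)
  also have "\<dots> \<le> (\<Sum>b\<in>S - {a}. 1)" by (intro sum_mono) auto
  also have "\<dots> = card S - 1" using assms by simp
  also have "\<dots> < card S" using assms by (metis card_gt_0_iff diff_less empty_iff zero_less_one)
  finally show ?thesis .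
qed

lemma lagrange_interpolation:
  assumes "finite S" "degree p < card S"
  shows "p = (\<Sum>a\<in>S. smult (poly p a) (lagrange_basis S a))"
proof (rule poly_eqI_degree[where A = S])
  show "degree p < card S" by fact
  show "degree (\<Sum>a\<in>S. smult (poly p a) (lagrange_basis S a)) < card S"
    using assms degree_lagrange_basis
    by (intro degree_sum_less) (auto intro: le_less_trans[OF degree_smult_le])
  show "poly p x = poly (\<Sum>a\<in>S. smult (poly p a) (lagrange_basis S a)) x" if "x \<in> S" for x
    using assms that by (simp add: poly_sum poly_lagrange_basis if_distrib[of "\<lambda>c. _ * c"] cong: if_cong)
qed

text \<open>A new node is added by a correction \<open>W * l\<close>, where \<open>W\<close>
  vanishes doubly at all old nodes and so leaves their data untouched; the two coefficients of the
  linear \<open>l\<close> meet the two new conditions.\<close>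

lemma hermite_interpolation_exists:
  fixes v d :: "real \<Rightarrow> real"
  assumes "finite A"
  shows "\<exists>f. degree f \<le> 2 * card A - 1 \<and> (\<forall>a\<in>A. poly f a = v a \<and> poly (pderiv f) a = d a)"
  using assms
proof induction
  case empty
  then show ?case by (intro exI[of _ 0]) auto
next
  case (insert a A)
  then obtain f where f: "degree f \<le> 2 * card A - 1"
    "\<And>b. b\<in>A \<Longrightarrow> poly f b = v b \<and> poly (pderiv f) b = d b" by auto
  define W where "W = (\<Prod>b\<in>A. [:-b,1:])^2"
  have degW: "degree W = 2 * card A" unfolding W_def using insert(1)
    by (subst degree_power_eq) (auto simp: degree_prod_eq_sum_degree)
  have Wa: "poly W a \<noteq> 0" using insert by (auto simp: W_def poly_prod)
  have W0: "poly W b = 0" "poly (pderiv W) b = 0" if "b \<in> A" for b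
    using that insert(1) by (auto simp: W_def poly_prod pderiv_power_Suc pderiv_mult power2_eq_square)
  \<comment> \<open>The system is triangular: the value at \<open>a\<close> determines
    \<open>c = l(a)\<close>, then the derivative determines the slope \<open>e\<close>.\<close>
  define c where "c = (v a - poly f a) / poly W a"
  define e where "e = (d a - poly (pderiv f) a - c * poly (pderiv W) a) / poly W a"
  define l where "l = [:c - e * a, e:]"
  have l: "poly l a = c" "poly (pderiv l) a = e" "degree l \<le> 1"
    by (auto simp: l_def pderiv_pCons)
  define g where "g = f + W * l"
  have "degree (W * l) \<le> 2 * card A + 1"
    by (rule order_trans[OF degree_mult_le]) (use l degW in auto)
  then have "degree g \<le> 2 * card (insert a A) - 1"
    unfolding g_def using f(1) insert by (intro degree_add_le) auto
  moreover have "poly g a = v a"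
    using Wa by (simp add: g_def l c_def)
  moreover have "poly (pderiv g) a = d a"
    using Wa by (simp add: g_def l e_def pderiv_mult pderiv_add)
  moreover have "poly g b = v b \<and> poly (pderiv g) b = d b" if "b \<in> A" for b
    using f(2)[OF that] W0[OF that] by (simp add: g_def pderiv_mult pderiv_add)
  ultimately show ?case by blast
qed

section \<open>Zero counting and the sign of the interpolation error\<close>

text \<open>The new zeros avoid \<open>Z\<close>, so they can be counted together with zeros that
  the derivative already has at points of \<open>Z\<close>. The bound \<open>Max Z\<close> lets the
  induction append a larger zero.\<close>

lemma Rolle_zeros:
  fixes g g' :: "real \<Rightarrow> real"
  assumes "finite Z" "Z \<noteq> {}" "Z \<subseteq> {u..v}" "\<And>z. z \<in> Z \<Longrightarrow> g z = 0"
    and cont: "continuous_on {u..v} g"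
    and deriv: "\<And>x. x \<in> {u<..<v} \<Longrightarrow> (g has_real_derivative g' x) (at x)"
  shows "\<exists>Y. finite Y \<and> Suc (card Y) = card Z \<and> Y \<subseteq> {u<..<Max Z} - Z \<and> (\<forall>y\<in>Y. g' y = 0)"
  using assms(1-4)
proof (induction rule: finite_linorder_max_induct)
  case empty
  then show ?case by simp
next
  case (insert b A)
  show ?case
  proof (cases "A = {}")
    case True
    then show ?thesis by (intro exI[of _ "{}"]) auto
  next
    case False
    with insert obtain Y where Y: "finite Y" "Suc (card Y) = card A" "Y \<subseteq> {u<..<Max A} - A" "\<forall>y\<in>Y. g' y = 0"
      by auto
    define m where "m = Max A"
    have mA: "m \<in> A" using insert(1) False by (simp add: m_def)
    have mb: "m < b" using mA insert by auto
    have in1: "u \<le> m" "b \<le> v" "g m = 0" "g b = 0" using mA insert by auto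
    have "\<exists>z>m. z < b \<and> (\<lambda>h. h * g' z) = (\<lambda>v. 0)"
    proof (rule Rolle_deriv)
      show "continuous_on {m..b} g" using cont by (rule continuous_on_subset) (use in1 in auto)
      show "(g has_derivative (\<lambda>h. h * g' x)) (at x)" if "m < x" "x < b" for x
        using deriv[of x] that in1 by (simp add: has_field_derivative_def mult.commute[of _ "g' x"])
    qed (use mb in1 in auto)
    then obtain z where z: "m < z" "z < b" "g' z = 0" by (metis mult_1)
    have Mx: "Max (insert b A) = b" using insert(1,2) by (intro Max_eqI) auto
    have notin: "z \<notin> Y" "z \<notin> A"
      using z Y(3) insert(1) by (auto simp: m_def) (meson Max_ge leD)
    have "Y \<subseteq> {u<..<b} - insert b A" using Y(3) mb by (auto simp: m_def)
    moreover have "z \<in> {u<..<b} - insert b A" using z notin in1 by auto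
    ultimately show ?thesis using Y z notin insert(1,2) Mx
      by (intro exI[of _ "insert z Y"]) (auto simp: card_insert_if)
  qed
qed

text \<open>Each differentiation costs one zero, so \<open>m + 1\<close> zeros at the start leave
  one after \<open>m\<close> steps.\<close>

lemma Rolle_iterated:
  fixes D :: "nat \<Rightarrow> real \<Rightarrow> real"
  assumes "finite Z" "Z \<subseteq> {a<..<b}" "card Z > m" "\<And>z. z \<in> Z \<Longrightarrow> D 0 z = 0"
    and "\<And>j x. j < m \<Longrightarrow> x \<in> {a<..<b} \<Longrightarrow> (D j has_real_derivative D (Suc j) x) (at x)"
  shows "\<exists>x\<in>{a<..<b}. D m x = 0"
  using assms
proof (induction m arbitrary: D Z)
  case 0
  then have "Z \<noteq> {}" by auto
  with 0 show ?case by blast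
next
  case (Suc m)
  have Z0: "Z \<noteq> {}" using Suc.prems(3) by auto
  have sub: "{Min Z..Max Z} \<subseteq> {a<..<b}"
    using Min_in[OF Suc.prems(1) Z0] Max_in[OF Suc.prems(1) Z0] Suc.prems(2) by (auto simp: subset_iff)
  have "\<exists>Y. finite Y \<and> Suc (card Y) = card Z \<and> Y \<subseteq> {Min Z<..<Max Z} - Z \<and> (\<forall>y\<in>Y. D 1 y = 0)"
  proof (rule Rolle_zeros[where v = "Max Z"])
    show "continuous_on {Min Z..Max Z} (D 0)"
      using Suc.prems(5)[of 0] sub
      by (intro continuous_at_imp_continuous_on ballI DERIV_isCont) blast
    show "(D 0 has_real_derivative D 1 x) (at x)" if "x \<in> {Min Z<..<Max Z}" for x
      using Suc.prems(5)[of 0 x] that subsetD[OF sub, of x] by auto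
  qed (use Suc.prems Z0 in auto)
  then obtain Y where Y: "finite Y" "Suc (card Y) = card Z" "Y \<subseteq> {Min Z<..<Max Z}" "\<forall>y\<in>Y. D 1 y = 0"
    by auto
  show ?case
  proof (rule Suc.IH[of Y "\<lambda>j. D (Suc j)"])
    show "Y \<subseteq> {a<..<b}" using Y(3) sub by (auto simp: subset_iff)
  qed (use Y Suc.prems in auto)
qed

lemma higher_pderiv_degree:
  fixes p :: "real poly"
  assumes "degree p \<le> m"
  shows "(pderiv ^^ m) p = [:fact m * coeff p m:]"
proof (rule poly_eqI)
  show "coeff ((pderiv ^^ m) p) n = coeff [:fact m * coeff p m:] n" for n
    using assms by (cases n) (auto simp: coeff_higher_pderiv pochhammer_fact coeff_eq_0)
qed

text \<open>Rolle is applied to \<open>h - f - K W\<close>, where \<open>W\<close> is the nodal polynomial of the interpolation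
  conditions and \<open>K\<close> is chosen so that the point \<open>t\<close> becomes an additional zero.\<close>

lemma hermite_interpolant_le:
  fixes h :: "real \<Rightarrow> real" and A B :: "real set"
  assumes fin: "finite A" "finite B" and A: "A \<subseteq> {a<..<b}" and B: "B \<subseteq> {a}"
    and cont: "continuous_on ({a<..<b} \<union> B) h"
    and D0: "D 0 = h"
    and D: "\<And>j x. j < 2 * card A + card B \<Longrightarrow> x \<in> {a<..<b} \<Longrightarrow> (D j has_real_derivative D (Suc j) x) (at x)"
    and Dpos: "\<And>x. x \<in> {a<..<b} \<Longrightarrow> D (2 * card A + card B) x \<ge> 0"
    and fdeg: "degree f < 2 * card A + card B"
    and fA: "\<And>x. x \<in> A \<Longrightarrow> poly f x = h x \<and> poly (pderiv f) x = D 1 x"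
    and fB: "\<And>x. x \<in> B \<Longrightarrow> poly f x = h x"
    and t: "t \<in> {a<..<b}"
  shows "poly f t \<le> h t"
proof (cases "t \<in> A")
  case True
  with fA show ?thesis by auto
next
  case False
  define m where "m = 2 * card A + card B"
  define W where "W = (\<Prod>x\<in>A. [:-x,1:])^2 * (\<Prod>x\<in>B. [:-x,1:])"
  have tB: "t \<notin> B" using t B by auto
  have m0: "m > 0" using fdeg unfolding m_def by (rule le_less_trans[OF le0])
  have degW: "degree W = m" unfolding W_def m_def
    by (subst degree_mult_eq) (auto simp: degree_power_eq degree_prod_eq_sum_degree fin)
  have lcW: "coeff W m = 1"
  proof -
    have "lead_coeff W = 1"
      unfolding W_def by (simp add: lead_coeff_mult lead_coeff_power lead_coeff_prod)
    then show ?thesis by (simp add: degW)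
  qed
  have Wt: "poly W t > 0"
  proof -
    have "poly (\<Prod>x\<in>B. [:-x,1:]) t > 0" unfolding poly_prod by (rule prod_pos) (use B t in auto)
    moreover have "poly (\<Prod>x\<in>A. [:-x,1:]) t \<noteq> 0" using False fin by (auto simp: poly_prod)
    ultimately show ?thesis by (simp add: W_def)
  qed
  have WA: "poly W x = 0" "poly (pderiv W) x = 0" if "x \<in> A" for x
  proof -
    have "poly (\<Prod>x\<in>A. [:-x,1:]) x = 0" using that fin by (auto simp: poly_prod)
    then show "poly W x = 0" "poly (pderiv W) x = 0" by (simp_all add: W_def pderiv_mult power2_eq_square)
  qed
  have WB: "poly W x = 0" if "x \<in> B" for x
    using that fin by (auto simp: W_def poly_prod)
  define K where "K = (h t - poly f t) / poly W t"
  define q where "q = f + smult K W"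
  define G where "G = (\<lambda>j x. D j x - poly ((pderiv ^^ j) q) x)"
  have G: "(G j has_real_derivative G (Suc j) x) (at x)" if "j < m" "x \<in> {a<..<b}" for j x
    unfolding G_def using D[of j x] that by (auto simp: m_def intro!: derivative_eq_intros)
  define Z where "Z = insert t (A \<union> B)"
  have Z: "finite Z" "Z \<noteq> {}" "Z \<subseteq> {a<..<b} \<union> B" and cZ: "card Z = Suc (card A + card B)"
  proof -
    have "A \<inter> B = {}" using A B by auto
    then show "card Z = Suc (card A + card B)"
      using fin False tB by (simp add: Z_def card_Un_disjoint)
  qed (use fin A t in \<open>auto simp: Z_def\<close>)
  have G0: "G 0 z = 0" if "z \<in> Z" for z
    using that fA fB WA WB Wt by (auto simp: Z_def G_def D0 q_def K_def)
  have sub: "{Min Z..Max Z} \<subseteq> {a<..<b} \<union> B" "{Min Z<..<Max Z} \<subseteq> {a<..<b}"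
  proof -
    \<comment> \<open>The endpoint \<open>a\<close> lies in the closed interval only when it is a
      node, which is when \<open>cont\<close> covers it.\<close>
    have "Min Z \<ge> a" "Max Z < b" "Min Z = a \<Longrightarrow> a \<in> B"
      using Min_in[OF Z(1,2)] Max_in[OF Z(1,2)] Z(3) B t by (auto simp: subset_iff)
    then show "{Min Z..Max Z} \<subseteq> {a<..<b} \<union> B" "{Min Z<..<Max Z} \<subseteq> {a<..<b}"
      by (auto simp: less_le)
  qed
  have "\<exists>Y. finite Y \<and> Suc (card Y) = card Z \<and> Y \<subseteq> {Min Z<..<Max Z} - Z \<and> (\<forall>y\<in>Y. G 1 y = 0)"
  proof (rule Rolle_zeros[where v = "Max Z"])
    show "continuous_on {Min Z..Max Z} (G 0)"
      unfolding G_def D0 by (intro continuous_intros continuous_on_subset[OF cont] sub)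
    show "(G 0 has_real_derivative G 1 x) (at x)" if "x \<in> {Min Z<..<Max Z}" for x
      using G[of 0 x] m0 that sub by auto
  qed (use G0 Z in auto)
  then obtain Y where Y: "finite Y" "Suc (card Y) = card Z" "Y \<subseteq> {Min Z<..<Max Z} - Z" "\<forall>y\<in>Y. G 1 y = 0"
    by auto
  \<comment> \<open>\<open>Y\<close> gives \<open>card A + card B\<close> zeros of
    \<open>G 1\<close> off the nodes, and the double zeros of \<open>G 0\<close> at \<open>A\<close>
    give \<open>card A\<close> more: \<open>m\<close> in total, enough for \<open>m - 1\<close>
    further differentiations.\<close>
  have "\<exists>x\<in>{a<..<b}. G (Suc (m - 1)) x = 0"
  proof (rule Rolle_iterated[where D = "\<lambda>j. G (Suc j)" and Z = "Y \<union> A"])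
    show "card (Y \<union> A) > m - 1"
      using Y fin cZ m0 by (subst card_Un_disjoint) (auto simp: Z_def m_def)
    show "G (Suc 0) z = 0" if "z \<in> Y \<union> A" for z
      using that Y fA WA by (auto simp: G_def q_def pderiv_add pderiv_smult)
  qed (use Y sub A fin G in auto)
  then obtain x where x: "x \<in> {a<..<b}" "G m x = 0" using m0 by auto
  have "degree q \<le> m" unfolding q_def using fdeg degW
    by (intro degree_add_le) (auto simp: m_def intro: order_trans[OF degree_smult_le])
  \<comment> \<open>\<open>W\<close> is monic of degree \<open>m\<close> and \<open>f\<close> has
    smaller degree, so this derivative is the constant \<open>fact m * K\<close>, and
    \<open>K\<close> inherits the sign of \<open>D m\<close>.\<close>
  then have "poly ((pderiv ^^ m) q) x = fact m * coeff q m"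
    by (simp add: higher_pderiv_degree)
  also have "coeff q m = K"
    using fdeg lcW by (simp add: q_def m_def coeff_eq_0)
  finally have "D m x = fact m * K" using x by (simp add: G_def)
  with Dpos[OF x(1)] have "fact m * K \<ge> 0" by (simp add: m_def)
  then have "K \<ge> 0" using mult_pos_neg[of "fact m" K] by (smt (verit) fact_gt_zero)
  with Wt show ?thesis by (simp add: K_def zero_le_divide_iff)
qed

section \<open>Jacobi polynomials and Gegenbauer moments\<close>

lemma has_integral_jacobi_weight:
  fixes a b :: real
  assumes "a > -1" "b > -1"
  shows "((\<lambda>t. (1 - t) powr a * (1 + t) powr b) has_integral 2 powr (a + b + 1) * Beta (a + 1) (b + 1)) {-1..1}"
proof -
  have "((\<lambda>t. t powr b * (1 - t) powr a) has_integral Beta (b + 1) (a + 1)) (cbox 0 1)"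
    using has_integral_Beta_real[of "b + 1" "a + 1"] assms by simp
  from has_integral_affinity[OF this, of "1/2" "1/2"]
  have "((\<lambda>x. ((1/2) * x + 1/2) powr b * (1 - ((1/2) * x + 1/2)) powr a) has_integral 2 * Beta (b + 1) (a + 1)) ((\<lambda>x. 2 * x + - 1) ` {0..1})"
    by simp
  also have "(\<lambda>x::real. 2 * x + - 1) ` {0..1} = {-1..1}"
    using image_affinity_atLeastAtMost[of 2 "-1" 0 "1::real"] by simp
  finally have "((\<lambda>x. 2 powr (a + b) * (((1/2) * x + 1/2) powr b * (1 - ((1/2) * x + 1/2)) powr a)) has_integral
      2 powr (a + b) * (2 * Beta (b + 1) (a + 1))) {-1..1}"
    by (rule has_integral_mult_right)
  also have "2 powr (a + b) * (2 * Beta (b + 1) (a + 1)) = 2 powr (a + b + 1) * Beta (a + 1) (b + 1)"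
    by (simp add: powr_add Beta_commute)
  finally show ?thesis
  proof (rule has_integral_eq[rotated])
    fix x :: real assume x: "x \<in> {-1..1}"
    have "((1/2) * x + 1/2) powr b = (1 + x) powr b / 2 powr b"
      using x by (subst powr_divide[symmetric]) (auto simp: field_simps)
    moreover have "(1 - ((1/2) * x + 1/2)) powr a = (1 - x) powr a / 2 powr a"
      using x by (subst powr_divide[symmetric]) (auto simp: field_simps)
    ultimately show "2 powr (a + b) * (((1/2) * x + 1/2) powr b * (1 - ((1/2) * x + 1/2)) powr a) = (1 - x) powr a * (1 + x) powr b"
      by (simp add: powr_add)
  qed
qed

lemma has_integral_jacobi_weight_shift:
  fixes a b :: real
  assumes "a > -1" "b > -1"
  shows "((\<lambda>t. (1 - t) ^ i * (1 + t) ^ j * ((1 - t) powr a * (1 + t) powr b)) has_integral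
     2 powr (a + b + real (i + j) + 1) * Beta (a + real i + 1) (b + real j + 1)) {-1..1}"
proof (rule has_integral_spike_finite[where S = "{-1,1}"])
  show "((\<lambda>t. (1 - t) powr (a + real i) * (1 + t) powr (b + real j)) has_integral
     2 powr (a + b + real (i + j) + 1) * Beta (a + real i + 1) (b + real j + 1)) {-1..1}"
    using has_integral_jacobi_weight[of "a + real i" "b + real j"] assms by (simp add: algebra_simps)
  show "(1 - t) ^ i * (1 + t) ^ j * ((1 - t) powr a * (1 + t) powr b) = (1 - t) powr (a + real i) * (1 + t) powr (b + real j)"
    if "t \<in> {-1..1} - {-1,1}" for t :: real
    using that by (auto simp: powr_add powr_realpow)
qed auto

text \<open>By Pascal's rule, a finite difference of order \<open>k + 1\<close> is one of order
  \<open>k\<close> applied to first differences.\<close>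

lemma sum_alternating_binomial_Suc:
  fixes f :: "nat \<Rightarrow> 'a::comm_ring_1"
  shows "(\<Sum>s\<le>Suc k. (-1) ^ s * of_nat (Suc k choose s) * f s) =
         (\<Sum>s\<le>k. (-1) ^ s * of_nat (k choose s) * (f s - f (Suc s)))"
proof -
  have "(\<Sum>s\<le>Suc k. (-1) ^ s * of_nat (Suc k choose s) * f s)
      = f 0 + (\<Sum>s\<le>k. (-1) ^ Suc s * of_nat (k choose Suc s) * f (Suc s)) - (\<Sum>s\<le>k. (-1) ^ s * of_nat (k choose s) * f (Suc s))"
    by (subst sum.atMost_Suc_shift) (simp add: algebra_simps sum.distrib sum_negf sum_subtractf)
  also have "f 0 + (\<Sum>s\<le>k. (-1) ^ Suc s * of_nat (k choose Suc s) * f (Suc s)) = (\<Sum>s\<le>Suc k. (-1) ^ s * of_nat (k choose s) * f s)"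
    by (simp only: sum.atMost_Suc_shift power_0 binomial_n_0 of_nat_1 mult_1)
  also have "\<dots> = (\<Sum>s\<le>k. (-1) ^ s * of_nat (k choose s) * f s)"
    by (simp only: sum.atMost_Suc binomial_eq_0[OF lessI] of_nat_0 mult_zero_right mult_zero_left add_0_right)
  finally show ?thesis by (simp add: algebra_simps sum_subtractf)
qed

text \<open>This is a difference of order \<open>k\<close> of a polynomial of degree
  \<open>j < k\<close> in \<open>s\<close>. A first difference of a Pochhammer symbol is a multiple
  of one of lower degree, which feeds the induction.\<close>

lemma sum_alternating_binomial_pochhammer:
  fixes c :: "'a::comm_ring_1"
  assumes "j < k"
  shows "(\<Sum>s\<le>k. (-1) ^ s * of_nat (k choose s) * pochhammer (c - of_nat s) j) = 0"
  using assms
proof (induction k arbitrary: j)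
  case (Suc k)
  show ?case
  proof (cases j)
    case 0
    then show ?thesis by (simp only: sum_alternating_binomial_Suc) simp
  next
    case (Suc i)
    have d: "pochhammer x (Suc i) - pochhammer (x - 1) (Suc i) = of_nat (Suc i) * pochhammer x i" for x :: 'a
      by (subst pochhammer_Suc, subst pochhammer_rec) (simp add: algebra_simps)
    have "pochhammer (c - of_nat s) j - pochhammer (c - of_nat (Suc s)) j = of_nat (Suc i) * pochhammer (c - of_nat s) i" for s
      using d[of "c - of_nat s"] by (simp add: Suc algebra_simps)
    then have "(\<Sum>s\<le>Suc k. (-1) ^ s * of_nat (Suc k choose s) * pochhammer (c - of_nat s) j)
       = of_nat (Suc i) * (\<Sum>s\<le>k. (-1) ^ s * of_nat (k choose s) * pochhammer (c - of_nat s) i)"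
      by (simp only: sum_alternating_binomial_Suc) (simp add: sum_distrib_left mult_ac)
    also have "\<dots> = 0" using Suc Suc.prems Suc.IH[of i] by simp
    finally show ?thesis .
  qed
qed simp

text \<open>With \<open>x = al + 1\<close> and \<open>y = be + 1\<close> the left side is a
  coefficient of \<open>jacobi_std\<close> times the Beta integral of its term. The Gamma factors
  depending on \<open>s\<close> cancel, and what remains is a summand of the vanishing alternating
  sum.\<close>

lemma gbinomial_Beta_product:
  fixes x y :: real
  assumes "x > 0" "y > 0" "s \<le> k"
  shows "((real k + x - 1) gchoose (k - s)) * ((real k + y - 1) gchoose s) * Beta (x + real s) (y + real (k - s) + real j)
    = Gamma (x + real k) * Gamma (y + real k) / (fact k * Gamma (x + y + real k + real j)) *
      (real (k choose s) * pochhammer (y + real k - real s) j)"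
proof -
  have "(real k + x - 1) gchoose (k - s) = pochhammer (x + real s) (k - s) / fact (k - s)"
    using assms by (simp add: gbinomial_pochhammer' of_nat_diff algebra_simps)
  also have "pochhammer (x + real s) (k - s) = Gamma (x + real k) / Gamma (x + real s)"
    using assms by (subst pochhammer_Gamma) (auto simp: of_nat_diff nonpos_Ints_def)
  finally have 1: "(real k + x - 1) gchoose (k - s) = Gamma (x + real k) / Gamma (x + real s) / fact (k - s)" .
  have "(real k + y - 1) gchoose s = pochhammer (y + real (k - s)) s / fact s"
    using assms by (simp add: gbinomial_pochhammer' of_nat_diff algebra_simps)
  also have "pochhammer (y + real (k - s)) s = Gamma (y + real k) / Gamma (y + real (k - s))"
    using assms by (subst pochhammer_Gamma) (auto simp: of_nat_diff nonpos_Ints_def)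
  finally have 2: "(real k + y - 1) gchoose s = Gamma (y + real k) / Gamma (y + real (k - s)) / fact s" .
  have "pochhammer (y + real (k - s)) j = Gamma (y + real (k - s) + real j) / Gamma (y + real (k - s))"
    using assms by (subst pochhammer_Gamma) (auto simp: of_nat_diff nonpos_Ints_def)
  moreover have "y + real (k - s) = y + real k - real s" using assms by (simp add: of_nat_diff)
  moreover have pos: "Gamma (x + real s) > 0" "Gamma (y + real (k - s)) > 0"
    using assms by (auto intro!: Gamma_real_pos add_pos_nonneg)
  ultimately have 3: "Gamma (y + real (k - s) + real j) = Gamma (y + real (k - s)) * pochhammer (y + real k - real s) j"
    by (simp add: add_diff_eq)
  have 4: "real (k choose s) = fact k / (fact s * fact (k - s))"
    using assms by (simp add: binomial_fact)
  have 5: "Beta (x + real s) (y + real (k - s) + real j) = Gamma (x + real s) * Gamma (y + real (k - s) + real j) / Gamma (x + y + real k + real j)"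
    using assms by (simp add: Beta_def of_nat_diff algebra_simps)
  show ?thesis unfolding 5 1 2 3 4 using pos by simp
qed

text \<open>Powers of \<open>1 + t\<close> serve as test polynomials because they merge with the
  factors \<open>(1 - t) ^ s * (1 + t) ^ (k - s)\<close> of the explicit formula, making every term
  a Beta integral.\<close>

lemma jacobi_std_orthogonal:
  assumes "al > -1" "be > -1" "j < k"
  shows "((\<lambda>t. poly (jacobi_std k al be) t * (1 + t) ^ j * ((1 - t) powr al * (1 + t) powr be)) has_integral 0) {-1..1}"
proof -
  define g where "g = (\<lambda>s. ((real k + al) gchoose (k - s)) * ((real k + be) gchoose s))"
  \<comment> \<open>The factor \<open>(-1) ^ s / 2 ^ k\<close> comes from writing
    \<open>((t - 1) / 2) ^ s * ((t + 1) / 2) ^ (k - s)\<close> with base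
    \<open>1 - t\<close>.\<close>
  have "((\<lambda>t. \<Sum>s\<le>k. g s * ((-1) ^ s / 2 ^ k) * ((1 - t) ^ s * (1 + t) ^ (k - s + j) * ((1 - t) powr al * (1 + t) powr be)))
     has_integral (\<Sum>s\<le>k. g s * ((-1) ^ s / 2 ^ k) * (2 powr (al + be + real (s + (k - s + j)) + 1) * Beta (al + real s + 1) (be + real (k - s + j) + 1)))) {-1..1}"
    using assms by (intro has_integral_sum has_integral_mult_right has_integral_jacobi_weight_shift) auto
  also have "(\<Sum>s\<le>k. g s * ((-1) ^ s / 2 ^ k) * (2 powr (al + be + real (s + (k - s + j)) + 1) * Beta (al + real s + 1) (be + real (k - s + j) + 1)))
     = (\<Sum>s\<le>k. 2 powr (al + be + real k + real j + 1) / 2 ^ k * (Gamma (al + 1 + real k) * Gamma (be + 1 + real k) / (fact k * Gamma (al + 1 + (be + 1) + real k + real j))) *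
         ((-1) ^ s * of_nat (k choose s) * pochhammer (be + 1 + real k - of_nat s) j))"
  proof (rule sum.cong[OF refl])
    fix s assume "s \<in> {..k}"
    then have s: "s \<le> k" by simp
    have e: "g s * Beta (al + real s + 1) (be + real (k - s + j) + 1) = Gamma (al + 1 + real k) * Gamma (be + 1 + real k) / (fact k * Gamma (al + 1 + (be + 1) + real k + real j)) *
      (real (k choose s) * pochhammer (be + 1 + real k - real s) j)"
      using gbinomial_Beta_product[of "al + 1" "be + 1" s k j] assms s
      by (simp add: g_def add_ac of_nat_diff del: of_nat_add) (simp add: algebra_simps)
    have p: "al + be + real (s + (k - s + j)) + 1 = al + be + real k + real j + 1" using s by simp
    have "g s * ((-1) ^ s / 2 ^ k) * (2 powr (al + be + real (s + (k - s + j)) + 1) * Beta (al + real s + 1) (be + real (k - s + j) + 1))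
       = ((-1) ^ s / 2 ^ k) * 2 powr (al + be + real k + real j + 1) * (g s * Beta (al + real s + 1) (be + real (k - s + j) + 1))"
      unfolding p by simp
    then show "g s * ((-1) ^ s / 2 ^ k) * (2 powr (al + be + real (s + (k - s + j)) + 1) * Beta (al + real s + 1) (be + real (k - s + j) + 1))
      = 2 powr (al + be + real k + real j + 1) / 2 ^ k * (Gamma (al + 1 + real k) * Gamma (be + 1 + real k) / (fact k * Gamma (al + 1 + (be + 1) + real k + real j))) *
         ((-1) ^ s * of_nat (k choose s) * pochhammer (be + 1 + real k - of_nat s) j)"
      unfolding e by simp
  qed
  also have "\<dots> = 0"
    by (subst sum_distrib_left[symmetric], subst sum_alternating_binomial_pochhammer[OF assms(3)]) simp
  finally show ?thesis
  proof (rule has_integral_eq[rotated])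
    fix t :: real
    have "poly (jacobi_std k al be) t = (\<Sum>s\<le>k. g s * ((-1) ^ s / 2 ^ k) * ((1 - t) ^ s * (1 + t) ^ (k - s)))"
      unfolding jacobi_std_def poly_sum
    proof (rule sum.cong[OF refl])
      fix s assume "s \<in> {..k}"
      then have "(2::real) ^ k = 2 ^ s * 2 ^ (k - s)" by (simp flip: power_add)
      moreover have "poly [:-1/2, 1/2:] t = (-1) * (1 - t) / 2" "poly [:1/2, 1/2:] t = (1 + t) / 2"
        by (simp_all add: field_simps)
      ultimately show "poly (smult (((real k + al) gchoose (k - s)) * ((real k + be) gchoose s)) ([:-1/2, 1/2:] ^ s * [:1/2, 1/2:] ^ (k - s))) t
         = g s * ((-1) ^ s / 2 ^ k) * ((1 - t) ^ s * (1 + t) ^ (k - s))"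
        unfolding poly_smult poly_mult poly_power by (simp only: power_divide power_mult_distrib) (simp add: g_def)
    qed
    then show "(\<Sum>s\<le>k. g s * ((-1) ^ s / 2 ^ k) * ((1 - t) ^ s * (1 + t) ^ (k - s + j) * ((1 - t) powr al * (1 + t) powr be)))
       = poly (jacobi_std k al be) t * (1 + t) ^ j * ((1 - t) powr al * (1 + t) powr be)"
      by (simp add: sum_distrib_right sum_distrib_left power_add mult_ac del: add_diff_assoc2 diff_add_assoc2)
  qed
qed

section \<open>The mean \<open>coeff0\<close>: positivity, moments, orthogonality\<close>

lemma gegen_weight_eq:
  assumes "t \<in> {-1..1}"
  shows "gegen_weight n t = (1 - t) powr ((real n - 3) / 2) * (1 + t) powr ((real n - 3) / 2)"
proof -
  have "1 - t\<^sup>2 = (1 - t) * (1 + t)" by (simp add: power2_eq_square algebra_simps)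
  then show ?thesis using assms by (simp add: gegen_weight_def powr_mult)
qed

text \<open>Used with \<open>c = 1\<close>, to reach the powers of \<open>1 + t\<close> whose
  weighted integrals are known.\<close>

lemma poly_taylor_expansion:
  fixes q :: "'a::idom poly"
  shows "poly q t = (\<Sum>i\<le>degree q. coeff (pcompose q [:- c, 1:]) i * (c + t) ^ i)"
proof -
  have "poly q t = poly (pcompose q [:-c, 1:]) (c + t)" by (simp add: poly_pcompose)
  also have "\<dots> = (\<Sum>i\<le>degree (pcompose q [:-c, 1:]). coeff (pcompose q [:- c, 1:]) i * (c + t) ^ i)"
    by (rule poly_altdef)
  finally show ?thesis by (simp add: degree_pcompose)
qed

text \<open>For \<open>n = 2\<close> the weight is unbounded near both endpoints, so integrability
  is taken from the Beta integrals; the exponent stays above \<open>-1\<close>.\<close>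

lemma integrable_gegen_weight:
  assumes "n \<ge> 2"
  shows "(\<lambda>t. poly f t * gegen_weight n t) integrable_on {-1..1}"
proof -
  define c where "c = (real n - 3) / 2"
  have c: "c > -1" using assms by (simp add: c_def field_simps)
  have "(\<lambda>t. \<Sum>i\<le>degree f. coeff (pcompose f [:- 1, 1:]) i * ((1 - t) ^ 0 * (1 + t) ^ i * ((1 - t) powr c * (1 + t) powr c))) integrable_on {-1..1}"
    by (intro integrable_sum integrable_on_mult_right has_integral_integrable[OF has_integral_jacobi_weight_shift] c) auto
  then show ?thesis
    by (rule integrable_eq)
       (simp add: gegen_weight_eq c_def[symmetric] poly_taylor_expansion[of f _ 1] sum_distrib_left sum_distrib_right mult_ac)
qed

lemma integral_gegen_weight_pos:
  assumes "n \<ge> 2"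
  shows "integral {-1..1} (gegen_weight n) > 0"
proof -
  define c where "c = (real n - 3) / 2"
  have c: "c > -1" using assms by (simp add: c_def field_simps)
  have "(gegen_weight n has_integral 2 powr (c + c + 1) * Beta (c + 1) (c + 1)) {-1..1}"
    by (rule has_integral_eq[OF _ has_integral_jacobi_weight[OF c c]]) (simp add: gegen_weight_eq c_def)
  then have "integral {-1..1} (gegen_weight n) = 2 powr (c + c + 1) * Beta (c + 1) (c + 1)"
    by (rule integral_unique)
  also have "\<dots> > 0" using c by (auto simp: Beta_def intro!: mult_pos_pos divide_pos_pos Gamma_real_pos)
  finally show ?thesis .
qed

lemma coeff0_add: "n \<ge> 2 \<Longrightarrow> coeff0 n (f + g) = coeff0 n f + coeff0 n g"
  by (simp add: coeff0_def distrib_right integral_add integrable_gegen_weight distrib_left)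

lemma coeff0_smult: "coeff0 n (smult c f) = c * coeff0 n f"
  by (simp add: coeff0_def mult.assoc)

lemma coeff0_0 [simp]: "coeff0 n 0 = 0"
  by (simp add: coeff0_def)

lemma coeff0_sum: "n \<ge> 2 \<Longrightarrow> coeff0 n (\<Sum>i\<in>I. f i) = (\<Sum>i\<in>I. coeff0 n (f i))"
  by (induction I rule: infinite_finite_induct) (simp_all add: coeff0_add)

lemma coeff0_1: "n \<ge> 2 \<Longrightarrow> coeff0 n 1 = 1"
  using integral_gegen_weight_pos[of n] by (simp add: coeff0_def gamma_const_def)

lemma gamma_const_pos: "n \<ge> 2 \<Longrightarrow> gamma_const n > 0"
  using integral_gegen_weight_pos[of n] by (simp add: gamma_const_def)

text \<open>The integral over \<open>{-1/2..1/2}\<close>, where the weight is continuous and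
  positive, is already positive: otherwise \<open>p\<close> would have infinitely many
  zeros.\<close>

lemma coeff0_pos:
  assumes n: "n \<ge> 2" and p: "p \<noteq> 0" "\<And>t. t \<in> {-1<..<1} \<Longrightarrow> poly p t \<ge> 0"
  shows "coeff0 n p > 0"
proof -
  define f where "f = (\<lambda>t. poly p t * gegen_weight n t)"
  have nn: "f t \<ge> 0" if "t \<in> {-1..1}" for t
  proof (cases "t \<in> {-1<..<1}")
    case True
    with p(2) show ?thesis by (simp add: f_def gegen_weight_def)
  next
    case False
    \<comment> \<open>Since \<open>0 powr x = 0\<close>, the weight is 0 at both endpoints, whatever
      the exponent and the sign of \<open>p\<close> there.\<close>
    with that have "t = 1 \<or> t = -1" by auto
    then show ?thesis by (auto simp: f_def gegen_weight_def)
  qed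
  have int: "f integrable_on {-1..1}" unfolding f_def by (rule integrable_gegen_weight[OF n])
  have cont: "continuous_on {-1/2..1/2} f"
  proof -
    have "1 - x\<^sup>2 \<noteq> 0" if "x \<in> {-1/2..1/2}" for x :: real
      using that by (auto simp: power2_eq_1_iff)
    then show ?thesis unfolding f_def gegen_weight_def by (intro continuous_intros) auto
  qed
  have "integral {-1/2..1/2} f \<ge> 0"
    using nn by (intro integral_nonneg integrable_continuous_real cont) auto
  moreover have "integral {-1/2..1/2} f \<noteq> 0"
  proof
    assume "integral {-1/2..1/2} f = 0"
    then have z: "f x = 0" if "x \<in> {-1/2..1/2}" for x
      using that integral_eq_0_iff[of "-1/2" "1/2" f] cont nn by fastforce
    have "poly p x = 0" if "x \<in> {-1/2..1/2}" for x
    proof -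
      have "1 - x\<^sup>2 \<noteq> 0" using that by (auto simp: power2_eq_1_iff)
      with z[OF that] show ?thesis by (auto simp: f_def gegen_weight_def)
    qed
    then have "{-1/2..1/2} \<subseteq> {x. poly p x = 0}" by auto
    then have "finite {-1/2..1/2::real}" using poly_roots_finite[OF p(1)] finite_subset by blast
    then show False by (simp add: infinite_Icc)
  qed
  moreover have "integral {-1/2..1/2} f \<le> integral {-1..1} f"
    using nn int integrable_continuous_real[OF cont] by (intro integral_subset_le) auto
  ultimately have "integral {-1..1} f > 0" by linarith
  then show ?thesis using gamma_const_pos[OF n] by (simp add: coeff0_def f_def)
qed

text \<open>Integrate the derivative of \<open>t ^ m * (1 - t\<^sup>2) powr ((n - 1) / 2)\<close>,
  which vanishes at both endpoints. For \<open>m = 0\<close> the truncated \<open>m - 1\<close> is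
  harmless, its factor being 0.\<close>

lemma coeff0_moment_aux:
  assumes n: "n \<ge> 2"
  shows "real m * coeff0 n (monom 1 (m - 1)) = (real m + real n - 1) * coeff0 n (monom 1 (m + 1))"
proof -
  define c where "c = (real n - 1) / 2"
  have c: "c > 0" using n by (simp add: c_def)
  define F where "F = (\<lambda>t::real. t ^ m * (1 - t\<^sup>2) powr c)"
  define q where "q = smult (real m) (monom 1 (m - 1)) + smult (- (real m + real n - 1)) (monom 1 (m + 1))"
  have "((\<lambda>t. poly q t * gegen_weight n t) has_integral (F 1 - F (-1))) {-1..1}"
  proof (rule fundamental_theorem_of_calculus_interior)
    \<comment> \<open>The exponent \<open>c\<close> is one more than that of the weight, hence
      positive: the antiderivative is continuous up to the endpoints even where the weight blows
      up.\<close>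
    have "continuous_on {-1..1} (\<lambda>t::real. (1 - t\<^sup>2) powr c)"
      using c by (intro continuous_on_powr' continuous_intros) (auto simp: abs_square_le_1 abs_le_iff)
    then show "continuous_on {-1..1} F" unfolding F_def by (intro continuous_on_mult) (auto intro: continuous_intros)
    fix t :: real assume t: "t \<in> {-1<..<1}"
    have pos: "1 - t\<^sup>2 > 0" using t abs_square_less_1[of t] by auto
    have "(F has_real_derivative (real m * t ^ (m - 1)) * (1 - t\<^sup>2) powr c + t ^ m * (c * (1 - t\<^sup>2) powr (c - 1) * (- 2 * t))) (at t)"
      unfolding F_def using pos by (auto intro!: derivative_eq_intros DERIV_powr simp: field_simps powr_diff)
    also have "(1 - t\<^sup>2) powr c = (1 - t\<^sup>2) * gegen_weight n t"
    proof -
      have "c = 1 + (real n - 3) / 2" by (simp add: c_def field_simps)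
      then show ?thesis using pos by (simp add: gegen_weight_def powr_add)
    qed
    also have "(1 - t\<^sup>2) powr (c - 1) = gegen_weight n t"
    proof -
      have "c - 1 = (real n - 3) / 2" by (simp add: c_def field_simps)
      then show ?thesis by (simp only: gegen_weight_def)
    qed
    also have "(real m * t ^ (m - 1)) * ((1 - t\<^sup>2) * gegen_weight n t) + t ^ m * (c * gegen_weight n t * (- 2 * t)) = poly q t * gegen_weight n t"
      by (cases m) (simp_all add: q_def c_def poly_monom field_simps power2_eq_square)
    finally show "(F has_vector_derivative poly q t * gegen_weight n t) (at t)"
      by (simp add: has_real_derivative_iff_has_vector_derivative)
  qed simp
  then have "integral {-1..1} (\<lambda>t. poly q t * gegen_weight n t) = 0"
    by (simp add: F_def integral_unique)
  then have "coeff0 n q = 0" by (simp add: coeff0_def)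
  then show ?thesis unfolding q_def by (simp add: coeff0_add[OF n] coeff0_smult algebra_simps)
qed

lemma coeff0_moment_odd: "n \<ge> 2 \<Longrightarrow> coeff0 n (monom 1 1) = 0"
  using coeff0_moment_aux[of n 0] by simp

lemma coeff0_moment_Suc_Suc:
  "n \<ge> 2 \<Longrightarrow> (real n + real j) * coeff0 n (monom 1 (j + 2)) = real (j + 1) * coeff0 n (monom 1 j)"
  using coeff0_moment_aux[of n "j + 1"] by (simp add: add_ac)

text \<open>The factor \<open>(1 + t) ^ e\<close> turns the Gegenbauer weight into the Jacobi weight
  with second parameter raised by \<open>e\<close>.\<close>

lemma coeff0_jacobi_orthogonal:
  assumes n: "n \<ge> 2" and q: "degree q < k"
  shows "coeff0 n ([:1,1:] ^ e * P_ab n 0 e k * q) = 0"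
proof -
  define c where "c = (real n - 3) / 2"
  have c: "c > -1" using n by (simp add: c_def field_simps)
  define J where "J = jacobi_std k c (real e + c)"
  have P: "P_ab n 0 e k = smult (1 / poly J 1) J"
    by (simp add: P_ab_def jacobi_norm_def J_def c_def)
  have "((\<lambda>t. \<Sum>i\<le>degree q. coeff (pcompose q [:- 1, 1:]) i * (poly J t * (1 + t) ^ i * ((1 - t) powr c * (1 + t) powr (real e + c))))
     has_integral (\<Sum>i\<le>degree q. coeff (pcompose q [:- 1, 1:]) i * 0)) {-1..1}"
    unfolding J_def using q c
    by (intro has_integral_sum has_integral_mult_right jacobi_std_orthogonal) auto
  then have "((\<lambda>t. poly J t * poly q t * ((1 - t) powr c * (1 + t) powr (real e + c))) has_integral 0) {-1..1}"
    by (simp add: poly_taylor_expansion[of q _ 1] sum_distrib_right sum_distrib_left mult_ac)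
  then have "((\<lambda>t. poly ([:1,1:] ^ e * J * q) t * gegen_weight n t) has_integral 0) {-1..1}"
  proof (rule has_integral_spike_finite[where S = "{-1,1}", rotated 2])
    fix t :: real assume t: "t \<in> {-1..1} - {-1,1}"
    then have "(1 + t) powr (real e + c) = (1 + t) ^ e * (1 + t) powr c"
      by (auto simp: powr_add powr_realpow)
    then show "poly ([:1,1:] ^ e * J * q) t * gegen_weight n t = poly J t * poly q t * ((1 - t) powr c * (1 + t) powr (real e + c))"
      using t by (simp add: gegen_weight_eq c_def[symmetric] poly_power)
  qed auto
  then have "coeff0 n ([:1,1:] ^ e * J * q) = 0" by (simp add: coeff0_def integral_unique)
  moreover have "[:1,1:] ^ e * P_ab n 0 e k * q = smult (1 / poly J 1) ([:1,1:] ^ e * J * q)"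
    by (simp add: P)
  ultimately show ?thesis by (simp only: coeff0_smult mult_zero_right)
qed

text \<open>The upper bound suffices here; equality comes out of the root count in
  \<open>P_ab_roots\<close>, without computing the leading coefficient.\<close>

lemma degree_P_ab: "degree (P_ab n a b k) \<le> k"
proof -
  have "degree (jacobi_std k x y) \<le> k" for x y
    unfolding jacobi_std_def
  proof (intro degree_sum_le order_trans[OF degree_smult_le])
    fix s assume "s \<in> {..k}"
    have "degree ([:-1/2, 1/2::real:] ^ s * [:1/2, 1/2:] ^ (k - s)) \<le> degree ([:-1/2, 1/2::real:] ^ s) + degree ([:1/2, 1/2::real:] ^ (k - s))"
      by (rule degree_mult_le)
    also have "\<dots> \<le> degree [:-1/2, 1/2::real:] * s + degree [:1/2, 1/2::real:] * (k - s)"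
      by (intro add_mono degree_power_le)
    finally show "degree ([:-1/2, 1/2::real:] ^ s * [:1/2, 1/2:] ^ (k - s)) \<le> k" using \<open>s \<in> {..k}\<close> by simp
  qed auto
  then show ?thesis by (auto simp: P_ab_def jacobi_norm_def intro: order_trans[OF degree_smult_le])
qed

lemma poly_P_ab_1:
  assumes "n \<ge> 2"
  shows "poly (P_ab n a b k) 1 = 1"
proof -
  have "poly (jacobi_std k x y) 1 = (real k + x) gchoose k" for x y
    by (simp add: jacobi_std_def poly_sum poly_power power_0_left if_distrib[of "\<lambda>c. _ * c"] cong: if_cong)
  moreover have "((real k + (real a + (real n - 3) / 2)) gchoose k) \<noteq> 0"
  proof -
    \<comment> \<open>The base equals \<open>a + (n - 1) / 2\<close>, so the normalizing denominator
      is nonzero.\<close>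
    have "pochhammer (real k + (real a + (real n - 3) / 2) - real k + 1) k > 0"
      using assms by (intro pochhammer_pos) (simp add: field_simps)
    then show ?thesis by (simp add: gbinomial_pochhammer')
  qed
  ultimately show ?thesis by (simp add: P_ab_def jacobi_norm_def)
qed

section \<open>Averages over the sphere\<close>

lemma nn_integral_lborel_translate:
  fixes f :: "'a::euclidean_space \<Rightarrow> ennreal"
  assumes [measurable]: "f \<in> borel_measurable borel"
  shows "(\<integral>\<^sup>+x. f (c + x) \<partial>lborel) = (\<integral>\<^sup>+x. f x \<partial>lborel)"
proof -
  have "(\<integral>\<^sup>+x. f x \<partial>lborel) = (\<integral>\<^sup>+x. f x \<partial>distr lborel borel ((+) c))"
    by (simp only: lborel_distr_plus)
  also have "\<dots> = (\<integral>\<^sup>+x. f (c + x) \<partial>lborel)" by (subst nn_integral_distr) auto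
  finally show ?thesis by simp
qed

lemma nn_integral_lborel_reflect:
  fixes f :: "'a::euclidean_space \<Rightarrow> ennreal"
  assumes [measurable]: "f \<in> borel_measurable borel"
  shows "(\<integral>\<^sup>+x. f (c - x) \<partial>lborel) = (\<integral>\<^sup>+x. f x \<partial>lborel)"
proof -
  have "lborel = distr lborel borel (\<lambda>x::'a. c + (-1) *\<^sub>R x)"
    using lborel_affine[of "-1" c] by (simp add: density_1)
  then have "(\<integral>\<^sup>+x. f x \<partial>lborel) = (\<integral>\<^sup>+x. f x \<partial>distr lborel borel (\<lambda>x::'a. c + (-1) *\<^sub>R x))"
    by simp
  also have "\<dots> = (\<integral>\<^sup>+x. f (c + (-1) *\<^sub>R x) \<partial>lborel)" by (subst nn_integral_distr) auto
  finally show ?thesis by simp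
qed

text \<open>The library's invariance lemmas need a well-ordered index type. Instead, translation invariance
  and Tonelli give \<open>\<lambda>(T\<^sup>-\<^sup>1 A) \<lambda>(B) = \<lambda>(A) \<lambda>(T\<^sup>-\<^sup>1 B)\<close>, and for the unit ball \<open>T\<^sup>-\<^sup>1 B = B\<close>.\<close>

lemma distr_lborel_orthogonal:
  fixes T :: "'a::euclidean_space \<Rightarrow> 'a"
  assumes T: "orthogonal_transformation T"
  shows "distr lborel borel T = lborel"
proof (rule measure_eqI)
  have lin: "linear T" using T by (rule orthogonal_transformation_linear)
  then have T_meas[measurable]: "T \<in> borel_measurable borel"
    by (intro borel_measurable_continuous_onI linear_continuous_on linear_conv_bounded_linear[THEN iffD1])
  have surj: "surj T" using T by (rule orthogonal_transformation_surj)
  fix A assume "A \<in> sets (distr lborel borel T)"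
  then have [measurable]: "A \<in> sets borel" by simp
  define B where "B = ball (0::'a) 1"
  have [measurable]: "B \<in> sets borel" by (simp add: B_def)
  have TB: "indicator B (T y) = (indicator B y :: ennreal)" for y
    using T by (simp add: B_def indicator_def orthogonal_transformation_norm)
  have "emeasure (distr lborel borel T) A * emeasure lborel B
      = (\<integral>\<^sup>+y. indicator A (T y) * emeasure lborel B \<partial>lborel)"
    by (simp add: nn_integral_multc nn_integral_distr flip: nn_integral_indicator)
  also have "\<dots> = (\<integral>\<^sup>+y. (\<integral>\<^sup>+x. indicator A (T y) * indicator B (T y - x) \<partial>lborel) \<partial>lborel)"
  proof (rule nn_integral_cong)
    fix y
    show "indicator A (T y) * emeasure lborel B = (\<integral>\<^sup>+x. indicator A (T y) * indicator B (T y - x) \<partial>lborel)"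
      using nn_integral_lborel_reflect[of "indicator B" "T y"] by (simp add: nn_integral_cmult)
  qed
  also have "\<dots> = (\<integral>\<^sup>+x. (\<integral>\<^sup>+y. indicator A (T y) * indicator B (T y - x) \<partial>lborel) \<partial>lborel)"
    by (rule lborel_pair.Fubini') measurable
  also have "\<dots> = (\<integral>\<^sup>+x. (\<integral>\<^sup>+y. indicator A (x + T y) * indicator B (T y) \<partial>lborel) \<partial>lborel)"
  proof (rule nn_integral_cong)
    fix x
    \<comment> \<open>Replacing \<open>y\<close> by \<open>z + y\<close> turns \<open>T y\<close>
      into \<open>x + T y\<close>, which moves the shift from the ball onto
      \<open>A\<close>.\<close>
    obtain z where z: "x = T z" using surj by auto
    show "(\<integral>\<^sup>+y. indicator A (T y) * indicator B (T y - x) \<partial>lborel) = (\<integral>\<^sup>+y. (indicator A (x + T y) * indicator B (T y) :: ennreal) \<partial>lborel)"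
      using nn_integral_lborel_translate[of "\<lambda>y. indicator A (T y) * indicator B (T y - x)" z]
      by (simp add: z linear_add[OF lin])
  qed
  also have "\<dots> = (\<integral>\<^sup>+y. (\<integral>\<^sup>+x. indicator A (x + T y) * indicator B (T y) \<partial>lborel) \<partial>lborel)"
    by (rule lborel_pair.Fubini') measurable
  also have "\<dots> = (\<integral>\<^sup>+y. emeasure lborel A * indicator B y \<partial>lborel)"
  proof (rule nn_integral_cong)
    fix y
    show "(\<integral>\<^sup>+x. indicator A (x + T y) * indicator B (T y) \<partial>lborel) = emeasure lborel A * indicator B y"
      using nn_integral_lborel_translate[of "indicator A" "T y"] by (simp add: nn_integral_multc TB add.commute)
  qed
  also have "\<dots> = emeasure lborel A * emeasure lborel B" by (simp add: nn_integral_cmult)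
  finally have "emeasure lborel B * emeasure (distr lborel borel T) A = emeasure lborel B * emeasure lborel A"
    by (simp only: mult.commute)
  moreover have "emeasure lborel B \<noteq> top"
    using emeasure_lborel_ball_finite[of "0::'a" 1] by (auto simp: B_def)
  moreover have "emeasure lborel B \<noteq> 0"
    using content_ball_pos[of 1 "0::'a"] unfolding B_def measure_def by force
  ultimately show "emeasure (distr lborel borel T) A = emeasure lborel A"
    by (simp only: ennreal_mult_cancel_left) simp
qed simp

section \<open>Polar coordinates\<close>

lemma nn_integral_homogeneous_cball:
  fixes F :: "'a::euclidean_space \<Rightarrow> ennreal"
  assumes [measurable]: "F \<in> borel_measurable borel"
    and hom: "\<And>c x. c > 0 \<Longrightarrow> F (c *\<^sub>R x) = F x" and a: "a > 0"
  shows "(\<integral>\<^sup>+x. F x * indicator (cball 0 a) x \<partial>lborel) =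
         ennreal (a ^ DIM('a)) * (\<integral>\<^sup>+x. F x * indicator (cball 0 1) x \<partial>lborel)"
proof -
  have [measurable]: "cball (0::'a) a \<in> sets borel" by simp
  have "(\<integral>\<^sup>+x. F x * indicator (cball 0 a) x \<partial>lborel) =
     (\<integral>\<^sup>+x. F x * indicator (cball 0 a) x \<partial>density (distr lborel borel (\<lambda>x. 0 + a *\<^sub>R x)) (\<lambda>_. \<bar>a\<bar>^DIM('a)))"
    using lborel_affine[of a "0::'a"] a by simp
  also have "\<dots> = (\<integral>\<^sup>+x. ennreal (a ^ DIM('a)) * (F x * indicator (cball 0 a) x) \<partial>distr lborel borel (\<lambda>x. a *\<^sub>R x))"
    using a assms(1) by (subst nn_integral_density) (auto intro!: borel_measurable_times_ennreal borel_measurable_indicator)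
  also have "\<dots> = (\<integral>\<^sup>+x. ennreal (a ^ DIM('a)) * (F (a *\<^sub>R x) * indicator (cball 0 a) (a *\<^sub>R x)) \<partial>lborel)"
    by (subst nn_integral_distr) auto
  also have "\<dots> = ennreal (a ^ DIM('a)) * (\<integral>\<^sup>+x. F (a *\<^sub>R x) * indicator (cball 0 a) (a *\<^sub>R x) \<partial>lborel)"
    by (rule nn_integral_cmult) measurable
  also have "(\<lambda>x. F (a *\<^sub>R x) * indicator (cball 0 a) (a *\<^sub>R x)) = (\<lambda>x. F x * indicator (cball 0 1) (x::'a))"
    using a hom by (auto simp: indicator_def fun_eq_iff field_simps)
  finally show ?thesis .
qed

text \<open>Under the norm, the measure with density \<open>F\<close> is pushed to a measure on the
  line that is determined by its values on the rays \<open>{..a}\<close>. By scaling these are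
  \<open>J * a ^ n\<close>, whose derivative is the radial density. Taking \<open>J\<close> over the
  solid ball avoids any surface measure.\<close>

lemma nn_integral_polar:
  fixes F :: "'a::euclidean_space \<Rightarrow> ennreal" and \<phi> :: "real \<Rightarrow> ennreal"
  assumes F[measurable]: "F \<in> borel_measurable borel"
    and hom: "\<And>c x. c > 0 \<Longrightarrow> F (c *\<^sub>R x) = F x"
    and fin: "(\<integral>\<^sup>+x. F x * indicator (cball 0 1) x \<partial>lborel) < \<infinity>"
    and phi[measurable]: "\<phi> \<in> borel_measurable borel"
  shows "(\<integral>\<^sup>+x. F x * \<phi> (norm x) \<partial>lborel) =
     (\<integral>\<^sup>+x. F x * indicator (cball 0 1) x \<partial>lborel) *
     (\<integral>\<^sup>+s. \<phi> s * ennreal (real DIM('a) * s ^ (DIM('a) - 1)) * indicator {0..} s \<partial>lborel)"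
proof -
  define n where "n = DIM('a)"
  have n: "n > 0" by (simp add: n_def)
  define J where "J = (\<integral>\<^sup>+x. F x * indicator (cball 0 1) x \<partial>lborel)"
  have [measurable]: "cball (0::'a) a \<in> sets borel" for a by simp
  define M where "M = distr (density lborel F) borel norm"
  define N where "N = density lborel (\<lambda>s::real. J * (ennreal (real n * s ^ (n - 1)) * indicator {0..} s))"
  have M_eq: "emeasure M {..a} = (\<integral>\<^sup>+x. F x * indicator (cball 0 a) x \<partial>lborel)" for a
  proof -
    have "norm -` {..a} = (cball 0 a :: 'a set)" by auto
    then show ?thesis unfolding M_def by (subst emeasure_distr) (auto simp: emeasure_density)
  qed
  have N_eq: "emeasure N {..a} = J * (\<integral>\<^sup>+s. ennreal (real n * s ^ (n - 1)) * indicator {0..a} s \<partial>lborel)" for a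
  proof -
    have "emeasure N {..a} = (\<integral>\<^sup>+s. J * (ennreal (real n * s ^ (n - 1)) * indicator {0..a} s) \<partial>lborel)"
      unfolding N_def by (subst emeasure_density) (auto simp: indicator_def intro!: nn_integral_cong)
    then show ?thesis by (simp add: nn_integral_cmult)
  qed
  have "M = N"
  proof (rule measure_eqI_generator_eq[where E = "range atMost" and A = "\<lambda>i. {..real i}" and \<Omega> = UNIV])
    show "Int_stable (range (atMost :: real \<Rightarrow> _))"
      by (auto simp: Int_stable_def)
    fix X :: "real set" assume "X \<in> range atMost"
    then obtain a where a: "X = {..a}" by auto
    show "emeasure M X = emeasure N X"
    proof (cases "a > 0")
      case True
      have "(\<integral>\<^sup>+s. ennreal (real n * s ^ (n - 1)) * indicator {0..a} s \<partial>lborel) = ennreal (a ^ n - 0 ^ n)"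
        using True n by (intro nn_integral_FTC_Icc) (auto intro!: derivative_eq_intros)
      then show ?thesis
        using nn_integral_homogeneous_cball[OF F hom True] n
        by (simp add: a M_eq N_eq J_def n_def mult.commute power_0_left)
    next
      case False
      \<comment> \<open>For \<open>a \<le> 0\<close> the ball contains at most the origin, a null
        set.\<close>
      have "AE x in lborel. F x * indicator (cball 0 a) x = 0"
        using AE_lborel_singleton[of "0::'a"]
      proof eventually_elim
        case (elim x)
        then have "norm x > a" using False zero_less_norm_iff[of x] by linarith
        then have "x \<notin> cball 0 a" by simp
        then show ?case by simp
      qed
      then have "emeasure M X = 0" unfolding a M_eq by (subst nn_integral_0_iff_AE) auto
      moreover have "AE s in lborel. ennreal (real n * s ^ (n - 1)) * indicator {0..a} s = 0"
        using AE_lborel_singleton[of "0::real"]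
        by eventually_elim (use False in \<open>auto simp: indicator_def\<close>)
      then have "(\<integral>\<^sup>+s. ennreal (real n * s ^ (n - 1)) * indicator {0..a} s \<partial>lborel) = 0"
        by (subst nn_integral_0_iff_AE) auto
      then have "emeasure N X = 0" by (simp add: a N_eq)
      ultimately show ?thesis by simp
    qed
  next
    show "sets M = sigma_sets UNIV (range atMost)" "sets N = sigma_sets UNIV (range atMost)"
      by (simp_all add: M_def N_def borel_eq_atMost)
    show "(\<Union>i. {..real i}) = UNIV" by (auto intro: real_arch_simple)
    show "emeasure M {..real i} \<noteq> \<infinity>" for i
    proof -
      \<comment> \<open>Passing to \<open>Suc i\<close> keeps the radius positive, as the scaling
        identity requires.\<close>
      have "emeasure M {..real i} \<le> emeasure M {..real (Suc i)}"
        by (intro emeasure_mono) (auto simp: M_def)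
      also have "\<dots> = ennreal (real (Suc i) ^ n) * J"
        using nn_integral_homogeneous_cball[OF F hom, of "real (Suc i)"] by (simp add: M_eq J_def n_def)
      also have "\<dots> < \<infinity>" using fin by (simp add: J_def ennreal_mult_less_top)
      finally show ?thesis by simp
    qed
  qed auto
  have "(\<integral>\<^sup>+x. F x * \<phi> (norm x) \<partial>lborel) = (\<integral>\<^sup>+s. \<phi> s \<partial>M)"
    by (simp add: M_def nn_integral_distr nn_integral_density)
  also have "\<dots> = J * (\<integral>\<^sup>+s. \<phi> s * ennreal (real n * s ^ (n - 1)) * indicator {0..} s \<partial>lborel)"
    unfolding \<open>M = N\<close> N_def
    by (subst nn_integral_density) (auto simp: nn_integral_cmult[symmetric] mult_ac intro!: nn_integral_cong)
  finally show ?thesis by (simp add: J_def n_def)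
qed

section \<open>Gaussian moments\<close>

text \<open>This is \<open>Gamma ((j + 1) / 2) / 2\<close>, the integral of
  \<open>exp (- s\<^sup>2) * s ^ j\<close> over the half-line, split by parity.\<close>

definition gauss_moment :: "nat \<Rightarrow> real" where
  "gauss_moment j = (if even j then sqrt pi / 2 * (fact j / (2 ^ j * fact (j div 2))) else fact (j div 2) / 2)"

lemma gauss_moment_pos: "gauss_moment j > 0"
  by (simp add: gauss_moment_def)

lemma has_bochner_integral_gauss_moment:
  "has_bochner_integral lborel (\<lambda>x::real. indicator {0..} x *\<^sub>R (exp (- x\<^sup>2) * x ^ j)) (gauss_moment j)"
proof (cases "even j")
  case True
  then show ?thesis using gaussian_moment_even_pos[of "j div 2"] by (simp add: gauss_moment_def)
next
  case False
  then have "j = 2 * (j div 2) + 1" by presburger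
  then show ?thesis using gaussian_moment_odd_pos[of "j div 2"] False by (simp add: gauss_moment_def)
qed

lemma gauss_moment_Suc_Suc: "gauss_moment (j + 2) = real (j + 1) / 2 * gauss_moment j"
proof (cases "even j")
  case True
  then obtain i where "j = 2 * i" by auto
  then show ?thesis by (simp add: gauss_moment_def divide_simps)
next
  case False
  then obtain i where "j = 2 * i + 1" by (auto elim: oddE)
  then show ?thesis by (simp add: gauss_moment_def divide_simps)
qed

lemma nn_integral_gauss_moment:
  "(\<integral>\<^sup>+x. ennreal (exp (- x\<^sup>2) * x ^ j) * indicator {0..} (x::real) \<partial>lborel) = ennreal (gauss_moment j)"
proof -
  have "(\<integral>\<^sup>+x. ennreal (indicator {0..} x *\<^sub>R (exp (- x\<^sup>2) * x ^ j)) \<partial>lborel) = ennreal (gauss_moment j)"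
    using has_bochner_integral_gauss_moment[of j]
    by (subst nn_integral_eq_integral) (auto simp: has_bochner_integral_iff indicator_def)
  then show ?thesis
    by (subst nn_integral_cong) (auto simp: indicator_def)
qed

lemma nn_integral_gauss_moment_even:
  assumes "even j"
  shows "(\<integral>\<^sup>+x. ennreal (exp (- x\<^sup>2) * (x::real) ^ j) \<partial>lborel) = ennreal (2 * gauss_moment j)"
proof -
  have "has_bochner_integral lborel (\<lambda>x::real. exp (- x\<^sup>2) * x ^ j) (2 *\<^sub>R gauss_moment j)"
    using has_bochner_integral_even_function[OF has_bochner_integral_gauss_moment[of j]] assms by simp
  then show ?thesis using assms
    by (subst nn_integral_eq_integral) (auto simp: has_bochner_integral_iff zero_le_even_power)
qed

text \<open>A rotation carries a coordinate vector \<open>e\<close> to \<open>x\<close>; the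
  integrand then splits into one-dimensional factors, the power sitting on the coordinate
  \<open>e\<close> alone. Evenness keeps the integrand nonnegative and doubles the half-line
  moments.\<close>

lemma nn_integral_gauss_inner:
  fixes x :: "real^'n"
  assumes x: "norm x = 1" and j: "even j"
  shows "(\<integral>\<^sup>+y. ennreal ((x \<bullet> y) ^ j * exp (- (norm y)\<^sup>2)) \<partial>lborel) =
         ennreal (2 * gauss_moment j * (2 * gauss_moment 0) ^ (CARD('n) - 1))"
proof -
  obtain e :: "real^'n" where e: "e \<in> Basis" using nonempty_Basis by blast
  obtain T where T: "orthogonal_transformation T" "T e = x"
    using orthogonal_transformation_exists[of e x] e x by auto
  have [measurable]: "T \<in> borel_measurable borel"
    using orthogonal_transformation_linear[OF T(1)]
    by (intro borel_measurable_continuous_onI linear_continuous_on linear_conv_bounded_linear[THEN iffD1])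
  have "(\<integral>\<^sup>+y. ennreal ((x \<bullet> y) ^ j * exp (- (norm y)\<^sup>2)) \<partial>lborel) =
        (\<integral>\<^sup>+y. ennreal ((x \<bullet> y) ^ j * exp (- (norm y)\<^sup>2)) \<partial>distr lborel borel T)"
    by (simp add: distr_lborel_orthogonal[OF T(1)])
  also have "\<dots> = (\<integral>\<^sup>+y. ennreal ((e \<bullet> y) ^ j * exp (- (norm y)\<^sup>2)) \<partial>lborel)"
    using T by (subst nn_integral_distr)
      (auto simp: orthogonal_transformation_norm orthogonal_transformation_def simp flip: T(2))
  also have "\<dots> = (\<integral>\<^sup>+y. (\<Prod>b\<in>Basis. ennreal (exp (- (y \<bullet> b)\<^sup>2) * (y \<bullet> b) ^ (if b = e then j else 0))) \<partial>lborel)"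
  proof (rule nn_integral_cong)
    fix y :: "real^'n"
    have "(\<Prod>b\<in>Basis. ennreal (exp (- (y \<bullet> b)\<^sup>2) * (y \<bullet> b) ^ (if b = e then j else 0)))
        = ennreal (\<Prod>b\<in>Basis. exp (- (y \<bullet> b)\<^sup>2) * (y \<bullet> b) ^ (if b = e then j else 0))"
      using j by (intro prod_ennreal) (auto intro: zero_le_even_power)
    also have "(\<Prod>b\<in>Basis. exp (- (y \<bullet> b)\<^sup>2) * (y \<bullet> b) ^ (if b = e then j else 0)) =
        exp (\<Sum>b\<in>Basis. - (y \<bullet> b)\<^sup>2) * (\<Prod>b\<in>Basis. if b = e then (y \<bullet> b) ^ j else 1)"
      unfolding exp_sum[OF finite_Basis] prod.distrib[symmetric] by (rule prod.cong) auto
    also have "(\<Prod>b\<in>Basis. if b = e then (y \<bullet> b) ^ j else 1) = (e \<bullet> y) ^ j"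
      using e by (simp add: inner_commute)
    also have "(\<Sum>b\<in>Basis. - (y \<bullet> b)\<^sup>2) = - (norm y)\<^sup>2"
      unfolding power2_norm_eq_inner by (subst euclidean_inner) (simp add: sum_negf power2_eq_square)
    finally show "ennreal ((e \<bullet> y) ^ j * exp (- (norm y)\<^sup>2)) =
       (\<Prod>b\<in>Basis. ennreal (exp (- (y \<bullet> b)\<^sup>2) * (y \<bullet> b) ^ (if b = e then j else 0)))"
      by (simp add: mult.commute)
  qed
  also have "\<dots> = (\<Prod>b\<in>Basis. (\<integral>\<^sup>+t. ennreal (exp (- t\<^sup>2) * t ^ (if b = e then j else 0)) \<partial>lborel))"
    by (rule nn_integral_lborel_prod) auto
  also have "\<dots> = (\<Prod>b\<in>Basis. ennreal (2 * gauss_moment (if b = e then j else 0)))"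
    using j by (intro prod.cong refl nn_integral_gauss_moment_even) auto
  also have "\<dots> = ennreal (\<Prod>b\<in>(Basis::(real^'n) set). 2 * gauss_moment (if b = e then j else 0))"
    by (intro prod_ennreal) (auto intro: less_imp_le gauss_moment_pos)
  also have "(\<Prod>b\<in>(Basis::(real^'n) set). 2 * gauss_moment (if b = e then j else 0))
     = 2 * gauss_moment j * (\<Prod>b\<in>(Basis::(real^'n) set) - {e}. 2 * gauss_moment 0)"
    by (subst prod.remove[OF _ e]) (auto intro!: prod.cong)
  also have "(\<Prod>b\<in>(Basis::(real^'n) set) - {e}. 2 * gauss_moment 0) = (2 * gauss_moment 0) ^ (CARD('n) - 1)"
    using e by (simp add: DIM_cart)
  finally show ?thesis .
qed

section \<open>Moments of the sphere and the reduction to one variable\<close>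

text \<open>The integrand that \<open>sphere_avg\<close> forms from
  \<open>(x \<bullet> y) ^ j\<close>. It is invariant under positive scaling of \<open>y\<close>, as
  \<open>nn_integral_polar\<close> demands.\<close>

definition direction_power :: "real^'n \<Rightarrow> nat \<Rightarrow> real^'n \<Rightarrow> real" where
  "direction_power x j y = (x \<bullet> ((1 / norm y) *\<^sub>R y)) ^ j"

lemma borel_measurable_direction_power [measurable]: "direction_power x j \<in> borel_measurable borel"
  unfolding direction_power_def[abs_def] by measurable

lemma direction_power_le_1:
  assumes "norm x = 1"
  shows "\<bar>direction_power x j y\<bar> \<le> 1"
proof -
  have "\<bar>x \<bullet> ((1 / norm y) *\<^sub>R y)\<bar> \<le> norm x * norm ((1 / norm y) *\<^sub>R y)" by (rule Cauchy_Schwarz_ineq2)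
  also have "\<dots> \<le> 1" using assms by simp
  finally show ?thesis unfolding direction_power_def power_abs by (rule power_le_one[rotated]) simp
qed

lemma integrable_direction_power:
  fixes x :: "real^'n"
  assumes "norm x = 1"
  shows "set_integrable lborel (ball 0 1) (direction_power x j)"
  unfolding set_integrable_def
proof (rule integrableI_bounded_set_indicator[where B = 1])
  show "emeasure lborel (ball (0::real^'n) 1) < \<infinity>"
    using emeasure_lborel_ball_finite by auto
qed (use direction_power_le_1[OF assms] in auto)

lemma integral_direction_power:
  fixes x :: "real^'n"
  assumes "norm x = 1"
  shows "direction_power x j integrable_on (ball 0 1)"
    and "integral (ball 0 1) (direction_power x j) = (LBINT y:ball 0 1. direction_power x j y)"
  using set_borel_integral_eq_integral[OF integrable_direction_power[OF assms]] by auto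

lemma integral_direction_power_odd:
  fixes x :: "real^'n"
  assumes "norm x = 1" "odd j"
  shows "integral (ball 0 1) (direction_power x j) = 0"
proof -
  let ?I = "LBINT y:ball 0 1. direction_power x j y"
  have o: "orthogonal_transformation (\<lambda>y::real^'n. - y)"
    by (simp add: orthogonal_transformation_neg orthogonal_transformation_id)
  have "?I = (\<integral>y. indicator (ball 0 1) y *\<^sub>R direction_power x j y \<partial>distr lborel borel (\<lambda>y. - y))"
    by (simp add: set_lebesgue_integral_def distr_lborel_orthogonal[OF o])
  also have "\<dots> = (\<integral>y. indicator (ball 0 1) (- y) *\<^sub>R direction_power x j (- y) \<partial>lborel)"
    by (intro integral_distr borel_measurable_scaleR borel_measurable_indicator) auto
  also have "\<dots> = - ?I"
    using assms by (simp add: set_lebesgue_integral_def direction_power_def indicator_def flip: integral_minus)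
  finally show ?thesis using integral_direction_power[OF assms(1)] by simp
qed

text \<open>Both sides are the Gaussian integral of \<open>(x \<bullet> y) ^ j\<close>: in polar
  coordinates, where the radial part contributes the moment of order \<open>j + n - 1\<close>, and
  in Cartesian ones.\<close>

lemma integral_direction_power_even:
  fixes x :: "real^'n"
  assumes x: "norm x = 1" and j: "even j"
  shows "integral (ball 0 1) (direction_power x j) * (real CARD('n) * gauss_moment (j + CARD('n) - 1))
     = 2 * gauss_moment j * (2 * gauss_moment 0) ^ (CARD('n) - 1)"
proof -
  define n where "n = CARD('n)"
  have n: "n > 0" by (simp add: n_def)
  define I where "I = integral (ball 0 1) (direction_power x j)"
  define F where "F = (\<lambda>y. ennreal (direction_power x j y))"
  have nn: "direction_power x j y \<ge> 0" for y
    using j by (simp add: direction_power_def zero_le_even_power)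
  have [measurable]: "F \<in> borel_measurable borel" unfolding F_def by measurable
  have I0: "I \<ge> 0" unfolding I_def using nn by (intro integral_nonneg integral_direction_power x) auto
  \<comment> \<open>Polar coordinates use closed balls and \<open>sphere_avg\<close> the open one;
    they differ by the sphere, a null set.\<close>
  have "(\<integral>\<^sup>+y. F y * indicator (cball 0 1) y \<partial>lborel) = (\<integral>\<^sup>+y. F y * indicator (ball 0 1) y \<partial>lborel)"
  proof (rule nn_integral_cong_AE)
    have "AE y::real^'n in lborel. y \<notin> sphere 0 1"
      using negligible_sphere[of "0::real^'n" 1]
      by (intro AE_not_in) (simp add: negligible_iff_null_sets null_sets_completion_iff)
    then show "AE y in lborel. F y * indicator (cball 0 1) y = F y * indicator (ball 0 1) y"
      by eventually_elim (auto simp: indicator_def)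
  qed
  also have "\<dots> = ennreal I"
  proof -
    have "(\<integral>\<^sup>+y. ennreal (indicator (ball 0 1) y *\<^sub>R direction_power x j y) \<partial>lborel) = ennreal I"
      unfolding I_def integral_direction_power(2)[OF x] set_lebesgue_integral_def
      using integrable_direction_power[OF x, of j] nn
      by (intro nn_integral_eq_integral) (auto simp: set_integrable_def)
    then show ?thesis
      by (subst nn_integral_cong) (auto simp: F_def indicator_def)
  qed
  finally have IF: "(\<integral>\<^sup>+y. F y * indicator (cball 0 1) y \<partial>lborel) = ennreal I" .
  have "(\<integral>\<^sup>+y. ennreal ((x \<bullet> y) ^ j * exp (- (norm y)\<^sup>2)) \<partial>lborel)
      = (\<integral>\<^sup>+y. F y * ennreal (norm y ^ j * exp (- (norm y)\<^sup>2)) \<partial>lborel)"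
  proof (rule nn_integral_cong)
    fix y :: "real^'n"
    have "(x \<bullet> y) ^ j = direction_power x j y * norm y ^ j"
      by (cases "y = 0") (auto simp: direction_power_def power_mult_distrib[symmetric])
    then show "ennreal ((x \<bullet> y) ^ j * exp (- (norm y)\<^sup>2)) = F y * ennreal (norm y ^ j * exp (- (norm y)\<^sup>2))"
      using nn by (simp add: F_def ennreal_mult'[symmetric] mult.assoc)
  qed
  also have "\<dots> = ennreal I * (\<integral>\<^sup>+s. ennreal (s ^ j * exp (- s\<^sup>2)) * ennreal (real n * s ^ (n - 1)) * indicator {0..} s \<partial>lborel)"
    using IF nn_integral_polar[of F "\<lambda>s. ennreal (s ^ j * exp (- s\<^sup>2))"]
    by (simp add: F_def direction_power_def n_def)
  also have "(\<integral>\<^sup>+s. ennreal (s ^ j * exp (- s\<^sup>2)) * ennreal (real n * s ^ (n - 1)) * indicator {0..} s \<partial>lborel)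
     = (\<integral>\<^sup>+s. ennreal (real n) * (ennreal (exp (- s\<^sup>2) * s ^ (j + n - 1)) * indicator {0..} (s::real)) \<partial>lborel)"
  proof (rule nn_integral_cong)
    fix s :: real
    have "s ^ (j + n - 1) = s ^ j * s ^ (n - 1)" using n by (simp flip: power_add)
    then show "ennreal (s ^ j * exp (- s\<^sup>2)) * ennreal (real n * s ^ (n - 1)) * indicator {0..} s
       = ennreal (real n) * (ennreal (exp (- s\<^sup>2) * s ^ (j + n - 1)) * indicator {0..} s)"
      by (auto simp: indicator_def ennreal_mult'[symmetric] mult_ac)
  qed
  also have "\<dots> = ennreal (real n * gauss_moment (j + n - 1))"
    by (subst nn_integral_cmult) (auto simp only: nn_integral_gauss_moment intro!: ennreal_mult'[symmetric], measurable)
  finally have "ennreal (I * (real n * gauss_moment (j + n - 1))) = ennreal (2 * gauss_moment j * (2 * gauss_moment 0) ^ (n - 1))"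
    using nn_integral_gauss_inner[OF x j] I0 by (simp add: ennreal_mult' n_def)
  then show ?thesis
    using I0 less_imp_le[OF gauss_moment_pos] by (subst (asm) ennreal_inj) (auto simp: I_def n_def)
qed

text \<open>For even \<open>j\<close> the Cartesian factors of the other coordinates cancel between
  \<open>j\<close> and \<open>j + 2\<close>; the moment recursion contributes \<open>j + 1\<close>
  on the Cartesian side and \<open>n + j\<close> on the radial side. For odd \<open>j\<close> both
  integrals vanish.\<close>

lemma integral_direction_power_Suc_Suc:
  fixes x :: "real^'n"
  assumes x: "norm x = 1"
  shows "(real CARD('n) + real j) * integral (ball 0 1) (direction_power x (j + 2))
       = real (j + 1) * integral (ball 0 1) (direction_power x j)"
proof (cases "even j")
  case False
  then show ?thesis using integral_direction_power_odd[OF x] by simp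
next
  case True
  define I where "I = (\<lambda>j. integral (ball 0 1) (direction_power x j))"
  define m where "m = j + CARD('n) - 1"
  have m: "j + 2 + CARD('n) - 1 = m + 2" "real (m + 1) = real CARD('n) + real j"
    using zero_less_card_finite[where 'a='n] by (simp_all add: m_def)
  define c where "c = (2 * gauss_moment 0) ^ (CARD('n) - 1)"
  have "I (j + 2) * (real CARD('n) * (real (m + 1) / 2 * gauss_moment m)) = 2 * (real (j + 1) / 2 * gauss_moment j) * c"
    using integral_direction_power_even[OF x, of "j + 2"] True
    unfolding m gauss_moment_Suc_Suc by (simp add: I_def c_def)
  moreover have "I j * (real CARD('n) * gauss_moment m) = 2 * gauss_moment j * c"
    using integral_direction_power_even[OF x True] by (simp add: I_def c_def m_def)
  ultimately have "(real CARD('n) * gauss_moment m) * (real (m + 1) * I (j + 2)) = (real CARD('n) * gauss_moment m) * (real (j + 1) * I j)"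
    by algebra
  moreover have "real CARD('n) * gauss_moment m \<noteq> 0" using gauss_moment_pos[of m] by simp
  ultimately have "real (m + 1) * I (j + 2) = real (j + 1) * I j" by (simp only: mult_cancel_left simp_thms)
  then show ?thesis by (simp only: m I_def)
qed

text \<open>Both sides satisfy \<open>(n + j) M (j + 2) = (j + 1) M j\<close> with the same \<open>M 0\<close> and \<open>M 1\<close>.\<close>

lemma sphere_avg_inner_power:
  fixes x :: "real^'n"
  assumes n: "CARD('n) \<ge> 2" and x: "norm x = 1"
  shows "sphere_avg (\<lambda>y. (x \<bullet> y) ^ j) = coeff0 CARD('n) (monom 1 j)"
proof -
  define V where "V = measure lebesgue (ball (0::real^'n) 1)"
  have V: "V > 0" unfolding V_def by (simp add: content_ball_pos)
  have avg: "sphere_avg (\<lambda>y. (x \<bullet> y) ^ j) = integral (ball 0 1) (direction_power x j) / V" for j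
    by (simp add: sphere_avg_def direction_power_def[abs_def] V_def)
  have "integral (ball 0 1) (direction_power x j) = V * coeff0 CARD('n) (monom 1 j)"
  proof (induction j rule: induct_nat_012)
    case 0
    have "integral (ball 0 1) (direction_power x 0) = integral (ball (0::real^'n) 1) (\<lambda>_. 1)"
      by (simp add: direction_power_def[abs_def])
    also have "\<dots> = V" by (simp add: V_def lmeasure_integral[symmetric])
    finally show ?case using coeff0_1[OF n] by (simp add: monom_0 one_pCons)
  next
    case 1
    then show ?case using coeff0_moment_odd[OF n] integral_direction_power_odd[OF x, of 1] by simp
  next
    case (ge2 j)
    have "(real CARD('n) + real j) * integral (ball 0 1) (direction_power x (j + 2)) = (real CARD('n) + real j) * (V * coeff0 CARD('n) (monom 1 (j + 2)))"
      using integral_direction_power_Suc_Suc[OF x, of j] coeff0_moment_Suc_Suc[OF n, of j] ge2(1)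
      by (metis mult.left_commute)
    moreover have "real CARD('n) + real j \<noteq> 0" using n by linarith
    ultimately show ?case by simp
  qed
  then show ?thesis using V by (simp add: avg)
qed

lemma sphere_avg_poly_inner:
  fixes x :: "real^'n"
  assumes n: "CARD('n) \<ge> 2" and x: "norm x = 1"
  shows "sphere_avg (\<lambda>y. poly f (x \<bullet> y)) = coeff0 CARD('n) f"
proof -
  have "sphere_avg (\<lambda>y. poly f (x \<bullet> y)) = (\<Sum>i\<le>degree f. coeff f i * sphere_avg (\<lambda>y. (x \<bullet> y) ^ i))"
  proof -
    have "integral (ball 0 1) (\<lambda>y. poly f (x \<bullet> ((1 / norm y) *\<^sub>R y)))
        = integral (ball 0 1) (\<lambda>y. \<Sum>i\<le>degree f. coeff f i * direction_power x i y)"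
      by (simp add: poly_altdef direction_power_def)
    also have "\<dots> = (\<Sum>i\<le>degree f. integral (ball 0 1) (\<lambda>y. coeff f i * direction_power x i y))"
      by (intro integral_sum integrable_on_mult_right integral_direction_power x) auto
    finally show ?thesis
      by (simp add: sphere_avg_def sum_divide_distrib direction_power_def[abs_def])
  qed
  also have "\<dots> = (\<Sum>i\<le>degree f. coeff0 CARD('n) (smult (coeff f i) (monom 1 i)))"
    using sphere_avg_inner_power[OF n x] by (simp add: coeff0_smult)
  also have "\<dots> = coeff0 CARD('n) (\<Sum>i\<le>degree f. smult (coeff f i) (monom 1 i))"
    using n by (simp add: coeff0_sum)
  also have "(\<Sum>i\<le>degree f. smult (coeff f i) (monom 1 i)) = f"
    by (simp add: smult_monom poly_as_sum_of_monoms)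
  finally show ?thesis .
qed

section \<open>Polynomial functions of several variables\<close>

lemma mpoly_fun_0: "(\<lambda>x. 0) \<in> mpoly_fun d"
  unfolding mpoly_fun_def by (intro CollectI exI[of _ "{}"]) auto

lemma mpoly_fun_1: "(\<lambda>x::real^'n. 1) \<in> mpoly_fun d"
  unfolding mpoly_fun_def
  by (intro CollectI exI[of _ "{\<lambda>_::'n. 0}"] exI[of _ "\<lambda>_. 1"]) auto

lemma mpoly_fun_mono: "d \<le> e \<Longrightarrow> mpoly_fun d \<subseteq> mpoly_fun e"
  unfolding mpoly_fun_def by (force intro: order_trans)

lemma mpoly_fun_cmult:
  assumes "f \<in> mpoly_fun d"
  shows "(\<lambda>x. c * f x) \<in> mpoly_fun d"
proof -
  obtain M a where M: "finite M" "\<forall>m\<in>M. (\<Sum>i\<in>UNIV. m i) \<le> d" "\<forall>x. f x = (\<Sum>m\<in>M. a m * (\<Prod>i\<in>UNIV. (x $ i) ^ (m i)))"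
    using assms unfolding mpoly_fun_def by blast
  then show ?thesis unfolding mpoly_fun_def
    by (intro CollectI exI[of _ M] exI[of _ "\<lambda>m. c * a m"]) (auto simp: sum_distrib_left mult.assoc)
qed

lemma mpoly_fun_add:
  assumes "f \<in> mpoly_fun d" "g \<in> mpoly_fun d"
  shows "(\<lambda>x. f x + g x) \<in> mpoly_fun d"
proof -
  obtain M a where M: "finite M" "\<forall>m\<in>M. (\<Sum>i\<in>UNIV. m i) \<le> d" "\<forall>x. f x = (\<Sum>m\<in>M. a m * (\<Prod>i\<in>UNIV. (x $ i) ^ (m i)))"
    using assms(1) unfolding mpoly_fun_def by blast
  obtain L b where L: "finite L" "\<forall>m\<in>L. (\<Sum>i\<in>UNIV. m i) \<le> d" "\<forall>x. g x = (\<Sum>m\<in>L. b m * (\<Prod>i\<in>UNIV. (x $ i) ^ (m i)))"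
    using assms(2) unfolding mpoly_fun_def by blast
  let ?c = "\<lambda>m. (if m \<in> M then a m else 0) + (if m \<in> L then b m else 0)"
  have "f x + g x = (\<Sum>m\<in>M \<union> L. ?c m * (\<Prod>i\<in>UNIV. (x $ i) ^ (m i)))" for x
  proof -
    have "f x = (\<Sum>m\<in>M \<union> L. (if m \<in> M then a m else 0) * (\<Prod>i\<in>UNIV. (x $ i) ^ (m i)))"
      using M L(1) by (auto intro!: sum.mono_neutral_cong_left)
    moreover have "g x = (\<Sum>m\<in>M \<union> L. (if m \<in> L then b m else 0) * (\<Prod>i\<in>UNIV. (x $ i) ^ (m i)))"
      using L M(1) by (auto intro!: sum.mono_neutral_cong_left)
    ultimately show ?thesis by (simp add: sum.distrib distrib_right)
  qed
  then show ?thesis using M L unfolding mpoly_fun_def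
    by (intro CollectI exI[of _ "M \<union> L"] exI[of _ ?c]) auto
qed

lemma mpoly_fun_sum:
  "(\<And>i. i \<in> I \<Longrightarrow> f i \<in> mpoly_fun d) \<Longrightarrow> (\<lambda>x. \<Sum>i\<in>I. f i x) \<in> mpoly_fun d"
  by (induction I rule: infinite_finite_induct) (auto simp: mpoly_fun_0 mpoly_fun_add)

lemma mpoly_fun_component_mult:
  fixes f :: "real^'n \<Rightarrow> real"
  assumes "f \<in> mpoly_fun d"
  shows "(\<lambda>x. x $ k * f x) \<in> mpoly_fun (Suc d)"
proof -
  obtain M a where M: "finite M" "\<forall>m\<in>M. (\<Sum>i\<in>UNIV. m i) \<le> d" "\<forall>x. f x = (\<Sum>m\<in>M. a m * (\<Prod>i\<in>UNIV. (x $ i) ^ (m i)))"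
    using assms unfolding mpoly_fun_def by blast
  \<comment> \<open>\<open>s\<close> raises the exponent of the coordinate \<open>k\<close>; its
    left inverse \<open>r\<close> finds the old coefficient of a shifted monomial.\<close>
  define s where "s = (\<lambda>m::'n \<Rightarrow> nat. m(k := Suc (m k)))"
  define r where "r = (\<lambda>m::'n \<Rightarrow> nat. m(k := m k - 1))"
  have rs: "r (s m) = m" for m by (simp add: r_def s_def)
  have inj: "inj_on s M" by (metis rs inj_on_inverseI)
  have su: "(\<Sum>i\<in>UNIV. s m i) = Suc (\<Sum>i\<in>UNIV. m i)" for m
    by (simp add: s_def sum.remove[of UNIV k])
  have pr: "(\<Prod>i\<in>UNIV. (x $ i) ^ (s m i)) = x $ k * (\<Prod>i\<in>UNIV. (x $ i) ^ (m i))" for m and x :: "real^'n"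
    by (simp add: s_def prod.remove[of UNIV k])
  have "x $ k * f x = (\<Sum>m\<in>s ` M. a (r m) * (\<Prod>i\<in>UNIV. (x $ i) ^ (m i)))" for x
    using M(3) by (simp add: sum.reindex[OF inj] rs pr sum_distrib_left mult_ac)
  then show ?thesis using M unfolding mpoly_fun_def
    by (intro CollectI exI[of _ "s ` M"] exI[of _ "\<lambda>m. a (r m)"]) (auto simp: su)
qed

lemma mpoly_fun_inner_power: "(\<lambda>y::real^'n. (x \<bullet> y) ^ j) \<in> mpoly_fun j"
proof (induction j)
  case (Suc j)
  have "(\<lambda>y::real^'n. (x \<bullet> y) ^ Suc j) = (\<lambda>y. \<Sum>k\<in>UNIV. x $ k * (y $ k * (x \<bullet> y) ^ j))"
    by (simp add: inner_vec_def sum_distrib_right mult.assoc)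
  then show ?case
    using Suc by (simp only:) (intro mpoly_fun_sum mpoly_fun_cmult mpoly_fun_component_mult)
qed (simp add: mpoly_fun_1)

lemma mpoly_fun_poly_inner:
  assumes "degree f \<le> d"
  shows "(\<lambda>y::real^'n. poly f (x \<bullet> y)) \<in> mpoly_fun d"
  unfolding poly_altdef
proof (intro mpoly_fun_sum mpoly_fun_cmult)
  fix i assume "i \<in> {..degree f}"
  then show "(\<lambda>y::real^'n. (x \<bullet> y) ^ i) \<in> mpoly_fun d"
    using mpoly_fun_inner_power[of x i] mpoly_fun_mono[of i d] assms by auto
qed

lemma spherical_design_sum_poly_inner:
  fixes C :: "(real^'n) set"
  assumes "CARD('n) \<ge> 2" "spherical_design d C" "norm x = 1" "degree f \<le> d"
  shows "(\<Sum>y\<in>C. poly f (x \<bullet> y)) = real (card C) * coeff0 CARD('n) f"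
proof -
  have "(\<Sum>y\<in>C. poly f (x \<bullet> y)) / real (card C) = sphere_avg (\<lambda>y. poly f (x \<bullet> y))"
    using assms mpoly_fun_poly_inner[OF assms(4), of x] unfolding spherical_design_def by blast
  moreover have "card C > 0" using assms by (auto simp: spherical_design_def card_gt_0_iff)
  ultimately show ?thesis using sphere_avg_poly_inner[OF assms(1,3)] by (simp add: field_simps)
qed

section \<open>Quadrature and the universal bound\<close>

text \<open>With fewer than \<open>k\<close> odd-order zeros inside, the polynomial \<open>q\<close>
  with exactly these simple zeros would be orthogonal to \<open>P\<close>, although
  \<open>P * q\<close> has constant sign.\<close>

lemma P_ab_roots:
  assumes n: "n \<ge> 2" and A: "A = {t. poly (P_ab n 0 e k) t = 0}"
  shows "finite A" "card A = k" "A \<subseteq> {-1<..<1}" "degree (P_ab n 0 e k) = k"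
proof -
  define P where "P = P_ab n 0 e k"
  have P0: "P \<noteq> 0" using poly_P_ab_1[OF n, of 0 e k] by (auto simp: P_def)
  have fin: "finite A" unfolding A using poly_roots_finite[OF P0] by (simp add: P_def)
  have cA: "card A \<le> degree P" unfolding A using card_poly_roots_bound[OF P0] by (simp add: P_def)
  have dP: "degree P \<le> k" by (simp add: P_def degree_P_ab)
  obtain R c where R: "finite R" "R \<subseteq> {-1<..<1}" "\<forall>r\<in>R. poly P r = 0" "c \<in> {1,-1::real}"
    and sg: "\<And>t. t \<in> {-1<..<1} \<Longrightarrow> c * poly (P * (\<Prod>r\<in>R. [:-r,1:])) t \<ge> 0"
    using sign_change_factor[OF P0, of "-1" 1] by blast
  define q where "q = (\<Prod>r\<in>R. [:-r,1:])"
  have q: "q \<noteq> 0" "degree q = card R"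
    using R(1) by (auto simp: q_def degree_prod_eq_sum_degree)
  have "k \<le> card R"
  proof (rule ccontr)
    assume "\<not> k \<le> card R"
    then have "coeff0 n ([:1,1:] ^ e * P * q) = 0"
      unfolding P_def using q by (intro coeff0_jacobi_orthogonal n) simp
    moreover have "coeff0 n (smult c ([:1,1:] ^ e * P * q)) > 0"
    proof (rule coeff0_pos[OF n])
      show "smult c ([:1,1:] ^ e * P * q) \<noteq> 0" using P0 q R(4) by auto
      fix t :: real assume t: "t \<in> {-1<..<1}"
      have "poly (smult c ([:1,1:] ^ e * P * q)) t = (1 + t) ^ e * (c * poly (P * q) t)"
        by (simp add: poly_power)
      also have "\<dots> \<ge> 0"
        using sg[OF t, folded q_def] by (rule mult_nonneg_nonneg[rotated]) (use t in simp)
      finally show "poly (smult c ([:1,1:] ^ e * P * q)) t \<ge> 0" .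
    qed
    ultimately show False by (simp only: coeff0_smult)
  qed
  \<comment> \<open>The chain \<open>k \<le> card R \<le> card A \<le> degree P \<le> k\<close>
    forces equality throughout, so \<open>R\<close> is the full root set.\<close>
  moreover have RA: "R \<subseteq> A" using R(3) by (auto simp: A P_def)
  then have "card R \<le> card A" using fin by (rule card_mono[rotated])
  ultimately have eq: "card A = k" "degree P = k" "card R = card A" using cA dP by linarith+
  then have "R = A" using RA fin by (intro card_subset_eq) auto
  with fin eq R(2) show "finite A" "card A = k" "A \<subseteq> {-1<..<1}" "degree (P_ab n 0 e k) = k"
    by (auto simp: P_def)
qed

text \<open>Division by the nodal polynomial \<open>W\<close> leaves a quotient of degree below
  \<open>k\<close>, annihilated by orthogonality, and a remainder that agrees with \<open>f\<close>
  at the nodes and is recovered from them by Lagrange interpolation.\<close>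

lemma gauss_jacobi_quadrature:
  assumes n: "n \<ge> 2" and e: "e \<le> 1" and S: "S = {t. poly ([:1,1:] ^ e * P_ab n 0 e k) t = 0}"
    and f: "degree f < 2 * k + e"
  shows "coeff0 n f = (\<Sum>a\<in>S. coeff0 n (lagrange_basis S a) * poly f a)"
proof -
  define P where "P = P_ab n 0 e k"
  define A where "A = {t. poly P t = 0}"
  note A = P_ab_roots[OF n A_def[unfolded P_def]]
  define W where "W = [:1,1:] ^ e * P"
  have S_eq: "S = A \<union> (if e = 1 then {-1} else {})"
    using e by (auto simp: S A_def P_def poly_power)
  have finS: "finite S" and cS: "card S = k + e"
    unfolding S_eq using A e by (auto simp: card_insert_if subset_iff)
  have P0: "P \<noteq> 0" using poly_P_ab_1[OF n, of 0 e k] by (auto simp: P_def)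
  have dW: "degree W = k + e" unfolding W_def using P0 A(4)
    by (subst degree_mult_eq) (auto simp: degree_power_eq P_def)
  define q r where "q = f div W" and "r = f mod W"
  have fqr: "f = W * q + r" by (simp add: q_def r_def)
  have W0: "W \<noteq> 0" using P0 by (simp add: W_def)
  have k0: "0 < k + e" using f by linarith
  have dr: "degree r < k + e" unfolding r_def using degree_mod_less[OF W0, of f] dW k0 by auto
  have Lq: "coeff0 n (W * q) = 0"
  proof (cases "q = 0")
    case False
    have "k + e + degree q = degree (f - r)"
      using W0 False by (simp add: fqr degree_mult_eq dW)
    also have "\<dots> < 2 * k + e" using f dr by (intro degree_diff_less) auto
    finally show ?thesis unfolding W_def P_def by (intro coeff0_jacobi_orthogonal n) simp
  qed simp
  have "coeff0 n f = coeff0 n r" by (simp add: fqr coeff0_add[OF n] Lq)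
  also have "\<dots> = coeff0 n (\<Sum>a\<in>S. smult (poly r a) (lagrange_basis S a))"
    using lagrange_interpolation[OF finS, of r] dr cS by simp
  also have "\<dots> = (\<Sum>a\<in>S. coeff0 n (lagrange_basis S a) * poly r a)"
    by (simp add: coeff0_sum[OF n] coeff0_smult mult.commute)
  also have "\<dots> = (\<Sum>a\<in>S. coeff0 n (lagrange_basis S a) * poly f a)"
    by (intro sum.cong refl) (auto simp: fqr S W_def P_def)
  finally show ?thesis .
qed

text \<open>The codomain is general so that the lemma applies in \<open>ereal\<close>, where the
  potential may be infinite at an endpoint.\<close>

lemma le_on_Icc_if_le_on_Ioo:
  fixes f g :: "real \<Rightarrow> 'b::linorder_topology"
  assumes "continuous_on {a..b} f" "continuous_on {a..b} g" "a < b"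
    and le: "\<And>t. t \<in> {a<..<b} \<Longrightarrow> f t \<le> g t" and t: "t \<in> {a..b}"
  shows "f t \<le> g t"
proof (rule tendsto_le)
  have "t islimpt {a<..<b}"
  proof (cases "t = a")
    case True
    then show ?thesis using islimpt_greaterThanLessThan1[OF assms(3)] by simp
  next
    case False
    then have "t islimpt {a<..<t}" using t by (intro islimpt_greaterThanLessThan2) auto
    then show ?thesis by (rule islimpt_subset) (use t in auto)
  qed
  then show "at t within {a<..<b} \<noteq> bot" by (simp add: trivial_limit_within)
  have "(g \<longlongrightarrow> g t) (at t within {a..b})" using assms(2) t by (simp add: continuous_on_def)
  then show "(g \<longlongrightarrow> g t) (at t within {a<..<b})" by (rule tendsto_within_subset) auto
  have "(f \<longlongrightarrow> f t) (at t within {a..b})" using assms(1) t by (simp add: continuous_on_def)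
  then show "(f \<longlongrightarrow> f t) (at t within {a<..<b})" by (rule tendsto_within_subset) auto
  show "\<forall>\<^sub>F x in at t within {a<..<b}. f x \<le> g x"
    using le by (auto simp: eventually_at_filter)
qed

text \<open>For odd order the sign condition makes the derivative of order \<open>2 k\<close> monotone, so Taylor's formula
  at 0 bounds the potential near \<open>-1\<close>; the value at the node \<open>-1\<close> is therefore finite.\<close>

lemma bounded_above_left_if_odd_deriv_nonneg:
  fixes D :: "nat \<Rightarrow> real \<Rightarrow> real"
  assumes k: "k \<ge> 1"
    and D: "\<And>j x. j < 2 * k + 1 \<Longrightarrow> x \<in> {-1<..<1} \<Longrightarrow> (D j has_real_derivative D (Suc j) x) (at x)"
    and Dpos: "\<And>x. x \<in> {-1<..<1} \<Longrightarrow> D (2 * k + 1) x \<ge> 0"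
  shows "\<exists>M. \<forall>t\<in>{-1<..<0}. D 0 t \<le> M"
proof (intro exI[of _ "(\<Sum>m<2 * k. \<bar>D m 0\<bar> / fact m) + \<bar>D (2 * k) 0\<bar> / fact (2 * k)"] ballI)
  fix t :: real assume t: "t \<in> {-1<..<0}"
  have "\<exists>x>t. x < 0 \<and> D 0 t = (\<Sum>m<2 * k. D m 0 / fact m * t ^ m) + D (2 * k) x / fact (2 * k) * t ^ (2 * k)"
    using t k D by (intro Maclaurin_minus) auto
  then obtain x where x: "t < x" "x < 0"
    "D 0 t = (\<Sum>m<2 * k. D m 0 / fact m * t ^ m) + D (2 * k) x / fact (2 * k) * t ^ (2 * k)" by blast
  have "D (2 * k) x \<le> D (2 * k) 0"
  proof (rule DERIV_nonneg_imp_nondecreasing[where f = "D (2 * k)"])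
    fix y assume "x \<le> y" "y \<le> 0"
    then have "y \<in> {-1<..<1}" using x t by auto
    then show "\<exists>z. (D (2 * k) has_real_derivative z) (at y) \<and> 0 \<le> z"
      using D[of "2 * k" y] Dpos[of y] by auto
  qed (use x in auto)
  then have "D (2 * k) x \<le> \<bar>D (2 * k) 0\<bar>" by linarith
  \<comment> \<open>The exponent is even, so for negative \<open>t\<close> the upper bound on the
    derivative stays an upper bound on the remainder.\<close>
  then have "D (2 * k) x / fact (2 * k) * t ^ (2 * k) \<le> \<bar>D (2 * k) 0\<bar> / fact (2 * k) * t ^ (2 * k)"
    by (intro mult_right_mono divide_right_mono) (auto simp: zero_le_even_power)
  also have "\<dots> \<le> \<bar>D (2 * k) 0\<bar> / fact (2 * k) * 1"
  proof (rule mult_left_mono)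
    have "\<bar>t\<bar> ^ (2 * k) \<le> 1" using t by (intro power_le_one) auto
    then show "t ^ (2 * k) \<le> 1" by (subst (asm) power_even_abs) auto
  qed simp
  finally have 1: "D (2 * k) x / fact (2 * k) * t ^ (2 * k) \<le> \<bar>D (2 * k) 0\<bar> / fact (2 * k)" by simp
  have "(\<Sum>m<2 * k. D m 0 / fact m * t ^ m) \<le> (\<Sum>m<2 * k. \<bar>D m 0\<bar> / fact m)"
  proof (rule sum_mono)
    fix m
    have "D m 0 / fact m * t ^ m \<le> \<bar>D m 0 / fact m * t ^ m\<bar>" by (rule abs_ge_self)
    also have "\<dots> = \<bar>D m 0\<bar> / fact m * \<bar>t\<bar> ^ m" by (simp add: abs_mult power_abs)
    also have "\<dots> \<le> \<bar>D m 0\<bar> / fact m * 1" using t by (intro mult_left_mono power_le_one) auto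
    finally show "D m 0 / fact m * t ^ m \<le> \<bar>D m 0\<bar> / fact m" by simp
  qed
  with 1 x(3) show "D 0 t \<le> (\<Sum>m<2 * k. \<bar>D m 0\<bar> / fact m) + \<bar>D (2 * k) 0\<bar> / fact (2 * k)" by linarith
qed

lemma Q_pot_ge_if_admissible:
  fixes C :: "(real^'n) set"
  assumes "CARD('n) \<ge> 2" "spherical_design \<tau> C" "f \<in> admissible_lower CARD('n) \<tau> h"
  shows "Q_pot h C \<ge> ereal (real (card C) * coeff0 CARD('n) f)"
  unfolding Q_pot_def
proof (rule INF_greatest)
  fix x :: "real^'n" assume "x \<in> sphere 0 1"
  then have x: "norm x = 1" by simp
  have le: "ereal (poly f (x \<bullet> y)) \<le> h (x \<bullet> y)" if "y \<in> C" for y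
  proof -
    have "norm y = 1" using that assms(2) by (auto simp: spherical_design_def)
    then have "x \<bullet> y \<in> {-1..1}" using Cauchy_Schwarz_ineq2[of x y] x by (auto simp: abs_le_iff)
    then show ?thesis using assms(3) by (auto simp: admissible_lower_def)
  qed
  have "ereal (real (card C) * coeff0 CARD('n) f) = ereal (\<Sum>y\<in>C. poly f (x \<bullet> y))"
    using spherical_design_sum_poly_inner[OF assms(1,2) x, of f] assms(3) by (simp add: admissible_lower_def)
  also have "\<dots> = (\<Sum>y\<in>C. ereal (poly f (x \<bullet> y)))" by simp
  also have "\<dots> \<le> U_pot h x C" unfolding U_pot_def using le by (rule sum_mono)
  finally show "ereal (real (card C) * coeff0 CARD('n) f) \<le> U_pot h x C" .
qed

text \<open>Carries every lower bound on the infimum over to the supremum; the sphere is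
  nonempty.\<close>

lemma Q_pot_le_R_pot: "Q_pot h (C :: (real^'n) set) \<le> R_pot h C"
proof -
  obtain b :: "real^'n" where "b \<in> Basis" using nonempty_Basis by blast
  then have b: "b \<in> sphere 0 1" by simp
  have "Q_pot h C \<le> U_pot h b C" unfolding Q_pot_def using b by (rule INF_lower)
  also have "\<dots> \<le> R_pot h C" unfolding R_pot_def using b by (rule SUP_upper)
  finally show ?thesis .
qed

lemma admissible_interpolant_exists:
  fixes h :: "real \<Rightarrow> ereal"
  defines "D \<equiv> \<lambda>j. (deriv ^^ j) (\<lambda>s. real_of_ereal (h s))"
  assumes A: "finite A" "A \<subseteq> {-1<..<1}" "card A = k" and e: "e \<le> 1" and k: "k \<ge> 1"
    and h_cont: "continuous_on {-1..1} h"
    and h_notminf: "\<forall>t\<in>{-1..1}. h t \<noteq> -\<infinity>"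
    and h_fin: "\<forall>t\<in>{-1<..<1}. h t \<noteq> \<infinity>"
    and D: "\<And>j x. j < 2 * k + e \<Longrightarrow> x \<in> {-1<..<1} \<Longrightarrow> (D j has_real_derivative D (Suc j) x) (at x)"
    and Dpos: "\<And>x. x \<in> {-1<..<1} \<Longrightarrow> D (2 * k + e) x \<ge> 0"
  shows "\<exists>f\<in>admissible_lower n (2 * k - 1 + e) h. \<forall>a\<in>A \<union> (if e = 1 then {-1} else {}). h a = ereal (poly f a)"
proof -
  define B where "B = (if e = 1 then {-1::real} else {})"
  have B: "finite B" "B \<subseteq> {-1}" "card B = e" using e by (auto simp: B_def)
  define hr where "hr = (\<lambda>s. real_of_ereal (h s))"
  have D0: "D 0 = hr" by (simp add: D_def hr_def)
  have inner: "h t = ereal (hr t)" if "t \<in> {-1<..<1}" for t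
    using that h_notminf h_fin by (cases "h t") (auto simp: hr_def)
  have hB: "h t = ereal (hr t)" if "t \<in> B" for t
  proof -
    have e1: "e = 1" and t: "t = -1" using that by (auto simp: B_def split: if_splits)
    obtain M where M: "\<And>t. t \<in> {-1<..<0} \<Longrightarrow> D 0 t \<le> M"
      using bounded_above_left_if_odd_deriv_nonneg[OF k D[unfolded e1] Dpos[unfolded e1]] by blast
    \<comment> \<open>The interior bound passes to the limit inside \<open>ereal\<close>, which
      rules out the value infinity at the node.\<close>
    have "h (-1) \<le> ereal M"
    proof (rule le_on_Icc_if_le_on_Ioo[where a = "-1" and b = 0 and f = h and g = "\<lambda>_. ereal M"])
      show "continuous_on {-1..0} h" by (rule continuous_on_subset[OF h_cont]) auto
      show "h t \<le> ereal M" if "t \<in> {-1<..<0}" for t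
        using M[OF that] inner[of t] that by (simp add: D0)
    qed auto
    then show ?thesis using h_notminf t by (cases "h (-1)") (auto simp: hr_def)
  qed
  obtain f0 where f0: "degree f0 \<le> 2 * card A - 1" "\<And>a. a \<in> A \<Longrightarrow> poly f0 a = hr a \<and> poly (pderiv f0) a = D 1 a"
    using hermite_interpolation_exists[OF A(1), of hr "D 1"] by blast
  define p where "p = (\<Prod>a\<in>A. [:-a,1:])"
  have p: "degree p = k" "poly p (-1) \<noteq> 0" "\<And>a. a \<in> A \<Longrightarrow> poly p a = 0"
    using A by (auto simp: p_def degree_prod_eq_sum_degree poly_prod)
  \<comment> \<open>The multiple of \<open>p\<^sup>2\<close> keeps values and derivatives at
    \<open>A\<close> and corrects the value at \<open>-1\<close>. The factor \<open>real e\<close>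
    switches it off for \<open>e = 0\<close>, where the degree must stay below
    \<open>2 * k\<close>.\<close>
  define f where "f = f0 + smult (real e * (hr (-1) - poly f0 (-1)) / (poly p (-1))\<^sup>2) (p\<^sup>2)"
  have deg: "degree f < 2 * k + e"
  proof (cases "e = 0")
    case True
    then show ?thesis using f0(1) A(3) k by (simp add: f_def)
  next
    case False
    have "degree (p\<^sup>2) \<le> 2 * k" using degree_power_le[of p 2] p(1) by simp
    then have "degree f \<le> 2 * k" unfolding f_def using f0(1) A(3)
      by (intro degree_add_le order_trans[OF degree_smult_le]) auto
    then show ?thesis using False by simp
  qed
  have fA: "poly f a = hr a \<and> poly (pderiv f) a = D 1 a" if "a \<in> A" for a
    using f0(2)[OF that] p(3)[OF that]
    by (simp add: f_def pderiv_add pderiv_smult pderiv_mult power2_eq_square)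
  have fB: "poly f a = hr a" if "a \<in> B" for a
    using that p(2) e by (auto simp: B_def f_def split: if_splits)
  have "poly f t \<le> hr t" if "t \<in> {-1<..<1}" for t
  proof (rule hermite_interpolant_le[where A = A and B = B and a = "-1" and b = 1 and D = D])
    have c: "continuous_on ({-1<..<1} \<union> B) h"
      by (rule continuous_on_subset[OF h_cont]) (use B(2) in auto)
    have fin: "\<bar>h x\<bar> \<noteq> \<infinity>" if "x \<in> {-1<..<1} \<union> B" for x
      using that inner[of x] hB[of x] by auto
    have "continuous_on ({-1<..<1} \<union> B) (real_of_ereal \<circ> h)"
      by (rule iffD1[OF continuous_on_iff_real[OF fin] c])
    then show "continuous_on ({-1<..<1} \<union> B) hr" by (simp only: o_def hr_def)
    show "(D j has_real_derivative D (Suc j) x) (at x)" if "j < 2 * card A + card B" "x \<in> {-1<..<1}" for j x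
      using D that by (simp only: A B)
    show "D (2 * card A + card B) x \<ge> 0" if "x \<in> {-1<..<1}" for x
      using Dpos[OF that] by (simp only: A B)
    show "degree f < 2 * card A + card B" using deg by (simp only: A B)
    show "poly f x = hr x \<and> poly (pderiv f) x = D 1 x" if "x \<in> A" for x by (rule fA[OF that])
    show "poly f x = hr x" if "x \<in> B" for x by (rule fB[OF that])
  qed (fact A B D0 that)+
  then have le: "ereal (poly f t) \<le> h t" if "t \<in> {-1<..<1}" for t using that inner by simp
  \<comment> \<open>The endpoints are reached in \<open>ereal\<close>, since \<open>h\<close> may be
    infinite at \<open>1\<close>, and at \<open>-1\<close> when that is not a node.\<close>
  have "ereal (poly f t) \<le> h t" if "t \<in> {-1..1}" for t
    by (rule le_on_Icc_if_le_on_Ioo[OF _ h_cont _ le that]) (auto intro!: continuous_intros)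
  then have "f \<in> admissible_lower n (2 * k - 1 + e) h"
    using deg k by (auto simp: admissible_lower_def)
  moreover have "h a = ereal (poly f a)" if "a \<in> A \<union> B" for a
    using that fA fB inner hB A(2) by auto
  ultimately show ?thesis unfolding B_def by blast
qed

theorem theorem3p4:
  fixes h :: "real \<Rightarrow> ereal" and k \<epsilon> N :: nat
  assumes n2: "CARD('n) \<ge> 2"
    and N1: "N \<ge> 1"
    and k1: "k \<ge> 1"
    and eps: "\<epsilon> \<in> {0, 1}"
    and ex_design: "\<exists>C :: (real^'n) set. spherical_design (2 * k - 1 + \<epsilon>) C \<and> card C = N"
    and h_cont: "continuous_on {-1..1} h"
    and h_notminf: "\<forall>t\<in>{-1..1}. h t \<noteq> -\<infinity>"
    and h_fin: "\<forall>t\<in>{-1<..<1}. h t \<noteq> \<infinity>"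
    and h_diff: "\<forall>t\<in>{-1<..<1}. \<forall>j\<le>2 * k - 1 + \<epsilon>.
        ((deriv ^^ j) (\<lambda>s. real_of_ereal (h s)) has_real_derivative
          (deriv ^^ Suc j) (\<lambda>s. real_of_ereal (h s)) t) (at t)"
    and h_deriv: "\<forall>t\<in>{-1<..<1}. (deriv ^^ (2 * k + \<epsilon>)) (\<lambda>s. real_of_ereal (h s)) t \<ge> 0"
  shows "let n = CARD('n); \<tau> = 2 * k - 1 + \<epsilon>;
             S = {t. poly ([:1, 1:] ^ \<epsilon> * P_ab n 0 \<epsilon> k) t = 0};
             \<rho> = (\<lambda>a. coeff0 n (lagrange_basis S a));
             B = ereal (real N) * (\<Sum>a\<in>S. ereal (\<rho> a) * h a)
         in (\<forall>a\<in>S. \<rho> a = coeff0 n ((lagrange_basis S a)\<^sup>2))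
          \<and> (\<forall>a\<in>S. \<rho> a > 0)
          \<and> (\<Sum>a\<in>S. \<rho> a) = 1
          \<and> Q_design TYPE('n) h \<tau> N \<ge> B
          \<and> R_design TYPE('n) h \<tau> N \<ge> B
          \<and> (\<exists>f\<in>admissible_lower n \<tau> h.
                (\<forall>g\<in>admissible_lower n \<tau> h. coeff0 n g \<le> coeff0 n f)
              \<and> ereal (real N * coeff0 n f) = B)"
proof -
  define n where "n = CARD('n)"
  define \<tau> where "\<tau> = 2 * k - 1 + \<epsilon>"
  define S where "S = {t. poly ([:1, 1:] ^ \<epsilon> * P_ab n 0 \<epsilon> k) t = 0}"
  define \<rho> where "\<rho> = (\<lambda>a. coeff0 n (lagrange_basis S a))"
  define B where "B = ereal (real N) * (\<Sum>a\<in>S. ereal (\<rho> a) * h a)"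
  have n: "n \<ge> 2" using n2 by (simp add: n_def)
  have e: "\<epsilon> \<le> 1" using eps by auto
  have tau: "\<tau> < 2 * k + \<epsilon>" "2 * k + \<epsilon> = Suc \<tau>" using k1 by (auto simp: \<tau>_def)
  define A where "A = {t. poly (P_ab n 0 \<epsilon> k) t = 0}"
  note A = P_ab_roots[OF n A_def]
  have S_eq: "S = A \<union> (if \<epsilon> = 1 then {-1} else {})"
    using e by (auto simp: S_def A_def poly_power)
  have finS: "finite S" and cS: "card S = k + \<epsilon>"
    unfolding S_eq using A e by (auto simp: card_insert_if subset_iff)
  have S_sub: "S \<subseteq> {-1..1}" using A(3) by (auto simp: S_eq subset_iff less_imp_le split: if_splits)
  have quad: "coeff0 n f = (\<Sum>a\<in>S. \<rho> a * poly f a)" if "degree f < 2 * k + \<epsilon>" for f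
    using gauss_jacobi_quadrature[OF n e S_def that] by (simp add: \<rho>_def)
  \<comment> \<open>The quadrature is applied to the square itself, which equals 1 at
    \<open>a\<close> and 0 at the other nodes; its degree is at most
    \<open>2 * (k + \<epsilon> - 1)\<close>, within range because
    \<open>\<epsilon> \<le> 1\<close>.\<close>
  have rho_sq: "\<rho> a = coeff0 n ((lagrange_basis S a)\<^sup>2)" if a: "a \<in> S" for a
  proof -
    have "degree ((lagrange_basis S a)\<^sup>2) \<le> 2 * (card S - 1)"
      using degree_power_le[of "lagrange_basis S a" 2] degree_lagrange_basis[OF finS a] by linarith
    then have "degree ((lagrange_basis S a)\<^sup>2) < 2 * k + \<epsilon>" using cS e k1 by linarith
    then have "coeff0 n ((lagrange_basis S a)\<^sup>2) = (\<Sum>b\<in>S. if a = b then \<rho> b else 0)"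
      using poly_lagrange_basis[OF finS a] by (auto simp: quad poly_power intro!: sum.cong)
    then show ?thesis using finS a by simp
  qed
  have rho_pos: "\<rho> a > 0" if a: "a \<in> S" for a
  proof -
    have "lagrange_basis S a \<noteq> 0" using poly_lagrange_basis[OF finS a a] by auto
    then show ?thesis unfolding rho_sq[OF a] by (intro coeff0_pos n) (auto simp: poly_power)
  qed
  have rho_sum: "(\<Sum>a\<in>S. \<rho> a) = 1" using quad[of 1] k1 coeff0_1[OF n] by simp
  obtain f where f: "f \<in> admissible_lower n \<tau> h" and fh: "\<And>a. a \<in> S \<Longrightarrow> h a = ereal (poly f a)"
    using admissible_interpolant_exists[OF A(1,3,2) e k1 h_cont h_notminf h_fin, of n] h_diff h_deriv tau(2)
    unfolding S_eq \<tau>_def[symmetric] by auto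
  have degf: "degree g < 2 * k + \<epsilon>" if "g \<in> admissible_lower n \<tau> h" for g
    using that tau by (simp add: admissible_lower_def)
  have B_eq: "B = ereal (real N * coeff0 n f)"
    unfolding B_def quad[OF degf[OF f]] by (simp add: fh)
  have opt: "coeff0 n g \<le> coeff0 n f" if g: "g \<in> admissible_lower n \<tau> h" for g
    unfolding quad[OF degf[OF f]] quad[OF degf[OF g]]
  proof (intro sum_mono mult_left_mono)
    fix a assume a: "a \<in> S"
    then have "ereal (poly g a) \<le> h a" using g S_sub by (auto simp: admissible_lower_def)
    then show "poly g a \<le> poly f a" using fh[OF a] by simp
  qed (use rho_pos in \<open>auto intro: less_imp_le\<close>)
  have Q: "B \<le> Q_pot h C" if "spherical_design \<tau> C" "card C = N" for C :: "(real^'n) set"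
    using Q_pot_ge_if_admissible[OF n2 that(1)] f that(2) by (auto simp: B_eq n_def)
  have "B \<le> Q_design TYPE('n) h \<tau> N"
  proof -
    \<comment> \<open>A supremum needs one member above \<open>B\<close>; over an empty family it
      would be minus infinity.\<close>
    obtain C :: "(real^'n) set" where C: "spherical_design \<tau> C" "card C = N"
      using ex_design by (auto simp: \<tau>_def)
    from Q[OF C] show ?thesis unfolding Q_design_def by (rule SUP_upper2[rotated]) (use C in auto)
  qed
  moreover have "B \<le> R_design TYPE('n) h \<tau> N"
    unfolding R_design_def using Q Q_pot_le_R_pot order_trans by (intro INF_greatest) blast
  ultimately have "(\<forall>a\<in>S. \<rho> a = coeff0 n ((lagrange_basis S a)\<^sup>2)) \<and> (\<forall>a\<in>S. \<rho> a > 0) \<and> (\<Sum>a\<in>S. \<rho> a) = 1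
      \<and> Q_design TYPE('n) h \<tau> N \<ge> B \<and> R_design TYPE('n) h \<tau> N \<ge> B
      \<and> (\<exists>f\<in>admissible_lower n \<tau> h. (\<forall>g\<in>admissible_lower n \<tau> h. coeff0 n g \<le> coeff0 n f)
            \<and> ereal (real N * coeff0 n f) = B)"
    using rho_sq rho_pos rho_sum f opt B_eq[symmetric] by blast
  then show ?thesis unfolding Let_def B_def \<rho>_def S_def \<tau>_def n_def .
qed

end
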